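(* Let $n\geq 1$ and $k\geq 2$ be integers, and let $r$ be an integer with $1\le r\le$ the number of length-$n$ bordered words over $\Sigma_k$. The bordered word $w\in\Sigma_k^n$ with rank $r$ (i.e., the $r$-th word in the lexicographic listing of all length-$n$ bordered words over $\Sigma_k$) can be computed from $r,n,k$ in $O(n^4k\log k)$ time using $O(n)$ space, under the unit-cost RAM model.
   Context: $\Sigma_k=\{1,2,\ldots,k\}$ with $1<2<\cdots<k$, and $\Sigma_k^n$ is the set of length-$n$ words over $\Sigma_k$. Lexicographic order: for $x=x_1\cdots x_m$ and $y=y_1\cdots y_n$, $x<y$ if $x$ is a proper prefix of $y$, or if $x_i<y_i$ for the smallest $i$ with $x_i\neq y_i$. A border of a word $w$ is a word that is both a non-empty proper prefix and a non-empty proper suffix of $w$; $w$ is bordered if it has a border. Ranks start at $1$. Unit-cost RAM model: integer variables use constant space and integer arithmetic operations take constant time. *)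

theory Defs
  imports Complex_Main
begin

definition is_border :: "nat list \<Rightarrow> nat list \<Rightarrow> bool" where
  "is_border u w \<longleftrightarrow> u \<noteq> [] \<and> length u < length w \<and>
     take (length u) w = u \<and> drop (length w - length u) w = u"

definition bordered :: "nat list \<Rightarrow> bool" where
  "bordered w \<longleftrightarrow> (\<exists>u. is_border u w)"

definition lex_less :: "nat list \<Rightarrow> nat list \<Rightarrow> bool" where
  "lex_less x y \<longleftrightarrow> (x, y) \<in> lexord {(a, b). a < b}"

definition bordered_words :: "nat \<Rightarrow> nat \<Rightarrow> nat list set" where
  "bordered_words n k = {w. length w = n \<and> set w \<subseteq> {1..k} \<and> bordered w}"

definition rank_bordered :: "nat \<Rightarrow> nat \<Rightarrow> nat list \<Rightarrow> nat" where
  "rank_bordered n k w = card {v \<in> bordered_words n k. lex_less v w} + 1"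

text \<open>Memory cells indexed by naturals, each holding an unbounded integer
  (constant space per cell); every instruction costs one time unit.
  Supports direct arithmetic, indirect addressing, conditional jumps.\<close>

datatype instr =
    Const nat int          (* M[i] := c *)
  | Add nat nat nat        (* M[i] := M[j] + M[l] *)
  | Sub nat nat nat
  | Mul nat nat nat
  | Div nat nat nat
  | Mod nat nat nat
  | Load nat nat           (* M[i] := M[M[j]] *)
  | Store nat nat          (* M[M[i]] := M[j] *)
  | Jz nat nat             (* if M[i] = 0 then goto t *)
  | Jmp nat
  | Halt

type_synonym prog = "instr list"

text \<open>Configuration: program counter, memory, set of memory cells accessed so far.\<close>
type_synonym config = "nat \<times> (nat \<Rightarrow> int) \<times> nat set"

definition halted :: "prog \<Rightarrow> config \<Rightarrow> bool" where
  "halted P c \<longleftrightarrow> fst c \<ge> length P \<or> P ! fst c = Halt"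

fun exec :: "instr \<Rightarrow> config \<Rightarrow> config" where
  "exec (Const i v) (pc, m, T) = (pc + 1, m(i := v), insert i T)"
| "exec (Add i j l) (pc, m, T) = (pc + 1, m(i := m j + m l), T \<union> {i, j, l})"
| "exec (Sub i j l) (pc, m, T) = (pc + 1, m(i := m j - m l), T \<union> {i, j, l})"
| "exec (Mul i j l) (pc, m, T) = (pc + 1, m(i := m j * m l), T \<union> {i, j, l})"
| "exec (Div i j l) (pc, m, T) = (pc + 1, m(i := m j div m l), T \<union> {i, j, l})"
| "exec (Mod i j l) (pc, m, T) = (pc + 1, m(i := m j mod m l), T \<union> {i, j, l})"
| "exec (Load i j) (pc, m, T) = (pc + 1, m(i := m (nat (m j))), T \<union> {i, j, nat (m j)})"
| "exec (Store i j) (pc, m, T) = (pc + 1, m(nat (m i) := m j), T \<union> {i, j, nat (m i)})"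
| "exec (Jz i t) (pc, m, T) = ((if m i = 0 then t else pc + 1), m, insert i T)"
| "exec (Jmp t) (pc, m, T) = (t, m, T)"
| "exec Halt c = c"

definition step :: "prog \<Rightarrow> config \<Rightarrow> config" where
  "step P c = (if halted P c then c else exec (P ! fst c) c)"

definition init_config :: "nat \<Rightarrow> nat \<Rightarrow> nat \<Rightarrow> config" where
  "init_config r n k = (0, (\<lambda>_. 0)(0 := int r, 1 := int n, 2 := int k), {0, 1, 2})"

definition computes_in :: "prog \<Rightarrow> nat \<Rightarrow> nat \<Rightarrow> nat \<Rightarrow> nat list \<Rightarrow> nat \<Rightarrow> nat \<Rightarrow> bool" where
  "computes_in P r n k w t s \<longleftrightarrow>
     (let c = (step P ^^ t) (init_config r n k) in
        halted P c \<and> (\<forall>i < length w. fst (snd c) (3 + i) = int (w ! i))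
        \<and> finite (snd (snd c)) \<and> card (snd (snd c)) \<le> s)"

end

theory Submission
  imports Defs
begin

text \<open>
  A bordered word has a unique unbordered border, namely its shortest one, and that border has at
  most half the length of the word. For a fixed prefix p of length L let U(m) be the number of
  unbordered words of length m that are consistent with p. Classifying the bordered words by their
  shortest border gives U(m) = k^(m - L) - (sum over j = 1..m div 2 of U(j) * G(m, j)),
  where G(m, j) counts the ways to extend an unbordered word of length j to a word of length m with
  that word as a border; G(m, j) is a product of one factor per position. Tabulating U up to n
  takes O(n^3) time and yields the number of bordered words of length n with prefix p. The word of
  rank r is then found letter by letter, with at most nk such counts.
\<close>

section \<open>Borders\<close>

text \<open>The shortest border is short because the two occurrences of a border of length j > m/2
  in a word of length m intersect in a border of length 2j - m < j. Hence the first j and the last j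
  letters do not overlap, and the letters from position j on can be chosen one after the other. G(m,
  j) is a product because the number of choices at a position never depends on the letters chosen
  before: where both the prefix and the border dictate a letter, the position copied from lies in
  the prefix too, so their agreement is a property of p alone. The recurrence also covers m < L,
  where U(m) is 1 or 0 according to whether the first m letters of p are unbordered. Each letter is
  found by linear search, which gives n^4 k; for k >= 2 the logarithm is at least 1. The machine
  only has jumps to absolute addresses, so the program is written in a small structured language
  whose preconditions carry a clock and a bound on the cells: one invariant per loop then yields
  correctness, termination, time and space together.\<close>

definition border_len :: "nat list \<Rightarrow> nat \<Rightarrow> bool" where
  "border_len v j \<longleftrightarrow> 1 \<le> j \<and> j < length v \<and> (\<forall>t<j. v ! t = v ! (length v - j + t))"

lemma bordered_iff_border_len: "bordered v \<longleftrightarrow> (\<exists>j. border_len v j)"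
proof
  assume "bordered v"
  then obtain u where u: "is_border u v" unfolding bordered_def by blast
  have "v ! t = v ! (length v - length u + t)" if "t < length u" for t
  proof -
    have "v ! t = take (length u) v ! t" using that by simp
    also have "\<dots> = drop (length v - length u) v ! t" using u unfolding is_border_def by simp
    also have "\<dots> = v ! (length v - length u + t)"
      using u unfolding is_border_def by (intro nth_drop) auto
    finally show ?thesis .
  qed
  then have "border_len v (length u)"
    using u unfolding border_len_def is_border_def by (auto simp: Suc_le_eq)
  then show "\<exists>j. border_len v j" ..
next
  assume "\<exists>j. border_len v j"
  then obtain j where j: "border_len v j" ..
  then have l: "1 \<le> j" "j < length v" and n: "\<And>t. t < j \<Longrightarrow> v ! t = v ! (length v - j + t)"
    unfolding border_len_def by auto
  have "take j v = drop (length v - j) v"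
  proof (rule nth_equalityI)
    fix t assume "t < length (take j v)"
    then show "take j v ! t = drop (length v - j) v ! t" using n[of t] l by simp
  qed (use l in simp)
  then have "is_border (take j v) v"
    using l by (auto simp: is_border_def)
  then show "bordered v" unfolding bordered_def ..
qed

text \<open>Used to see that a least border is itself unbordered: a border of it would be a still
  shorter border of \<open>v\<close>.\<close>

lemma border_len_take_trans:
  assumes "border_len v j" "border_len (take j v) i"
  shows "border_len v i"
  unfolding border_len_def
proof (intro conjI allI impI)
  have j: "j < length v" "\<forall>t<j. v ! t = v ! (length v - j + t)"
    and i: "1 \<le> i" "i < j" "\<forall>t<i. take j v ! t = take j v ! (j - i + t)"
    using assms unfolding border_len_def by auto
  show "1 \<le> i" "i < length v" using i j by auto
  fix t assume t: "t < i"
  have "v ! t = v ! (j - i + t)" using i t by auto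
  also have "\<dots> = v ! (length v - j + (j - i + t))" using j i t by auto
  also have "length v - j + (j - i + t) = length v - i + t" using i j by auto
  finally show "v ! t = v ! (length v - i + t)" .
qed

text \<open>The shorter border begins the longer one, and it ends the longer one because the copy of
  the latter at the end of \<open>v\<close> ends with it.\<close>

lemma border_len_take_of_less:
  assumes "border_len v j" "border_len v i" "i < j"
  shows "border_len (take j v) i"
  unfolding border_len_def
proof (intro conjI allI impI)
  have j: "j < length v" "\<forall>t<j. v ! t = v ! (length v - j + t)"
    and i: "1 \<le> i" "\<forall>t<i. v ! t = v ! (length v - i + t)"
    using assms unfolding border_len_def by auto
  show "1 \<le> i" "i < length (take j v)" using i j assms(3) by auto
  fix t assume t: "t < i"
  have "v ! (j - i + t) = v ! (length v - j + (j - i + t))" using j assms(3) t by auto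
  also have "length v - j + (j - i + t) = length v - i + t" using assms(3) j by auto
  finally show "take j v ! t = take j v ! (length (take j v) - i + t)"
    using i t assms(3) j by auto
qed

text \<open>A border of length \<open>j\<close> is a period \<open>length v - j\<close>; applying
  the period twice gives a period twice as long, which is again a border. A least border therefore
  cannot overlap itself.\<close>

lemma border_len_overlap:
  assumes "border_len v j" "length v < 2 * j"
  shows "border_len v (2 * j - length v)"
  unfolding border_len_def
proof (intro conjI allI impI)
  have j: "j < length v" "\<forall>t<j. v ! t = v ! (length v - j + t)"
    using assms unfolding border_len_def by auto
  show "1 \<le> 2 * j - length v" "2 * j - length v < length v" using assms(2) j by auto
  fix t assume t: "t < 2 * j - length v"
  have "v ! t = v ! (length v - j + t)" using j t by auto
  also have "\<dots> = v ! (length v - j + (length v - j + t))" using j t by auto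
  also have "length v - j + (length v - j + t) = length v - (2 * j - length v) + t"
    using j assms(2) by auto
  finally show "v ! t = v ! (length v - (2 * j - length v) + t)" .
qed

lemma bordered_iff_short_unbordered_border:
  "bordered v \<longleftrightarrow>
    (\<exists>j\<in>{1..length v div 2}. border_len v j \<and> \<not> bordered (take j v))"
proof
  assume "bordered v"
  then obtain j0 where "border_len v j0" unfolding bordered_iff_border_len ..
  then obtain j where j: "border_len v j" and least: "\<And>i. border_len v i \<Longrightarrow> j \<le> i"
    by (metis LeastI Least_le)
  have "\<not> length v < 2 * j"
    using least[OF border_len_overlap[OF j]] j unfolding border_len_def by linarith
  moreover have "\<not> bordered (take j v)"
  proof
    assume "bordered (take j v)"
    then obtain i where i: "border_len (take j v) i" unfolding bordered_iff_border_len ..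
    then have "i < j" by (auto simp: border_len_def)
    then show False using least[OF border_len_take_trans[OF j i]] by simp
  qed
  moreover have "1 \<le> j" using j by (simp add: border_len_def)
  ultimately show "\<exists>j\<in>{1..length v div 2}. border_len v j \<and> \<not> bordered (take j v)"
    using j by (intro bexI[of _ j]) auto
qed (auto simp: bordered_iff_border_len)

text \<open>Of two distinct borders the shorter is a border of the longer, which is then bordered.
  This makes the classes in the count disjoint.\<close>

lemma unbordered_border_unique:
  assumes "border_len v i" "\<not> bordered (take i v)" "border_len v j" "\<not> bordered (take j v)"
  shows "i = j"
proof (rule linorder_cases[of i j])
  assume "i < j"
  then show ?thesis using border_len_take_of_less[OF assms(3,1)] assms(4) bordered_iff_border_len by blast
next
  assume "j < i"
  then show ?thesis using border_len_take_of_less[OF assms(1,3)] assms(2) bordered_iff_border_len by blast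
qed

section \<open>Counting words with a given prefix\<close>

text \<open>The prefix has values in \<open>int\<close> because it is read straight off the memory
  of the machine. Only positions below both \<open>m\<close> and \<open>L\<close> are compared, so
  words shorter than the prefix are allowed.\<close>

definition consistent_words :: "nat \<Rightarrow> (nat \<Rightarrow> int) \<Rightarrow> nat \<Rightarrow> nat \<Rightarrow> nat list set" where
  "consistent_words k p L m =
    {v. length v = m \<and> set v \<subseteq> {1..k} \<and> (\<forall>t<m. t < L \<longrightarrow> int (v ! t) = p t)}"

definition unbordered_count :: "nat \<Rightarrow> (nat \<Rightarrow> int) \<Rightarrow> nat \<Rightarrow> nat \<Rightarrow> nat" where
  "unbordered_count k p L m = card {v \<in> consistent_words k p L m. \<not> bordered v}"

text \<open>The number of choices for the letter at position t, when a word is extended to a word whose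
  suffix starting at position d is a border.\<close>

definition ext_factor :: "nat \<Rightarrow> (nat \<Rightarrow> int) \<Rightarrow> nat \<Rightarrow> nat \<Rightarrow> nat \<Rightarrow> nat" where
  "ext_factor k p L d t =
    (if t < L then (if t < d \<or> p t = p (t - d) then 1 else 0) else if t < d then k else 1)"

lemma finite_consistent_words: "finite (consistent_words k p L m)"
  unfolding consistent_words_def
  by (rule finite_subset[OF _ finite_lists_length_eq[of "{1..k}" m]]) auto

section \<open>Counting extensions by appending one letter at a time\<close>

lemma card_snoc_extensions:
  assumes "finite A" "\<And>v. v \<in> A \<Longrightarrow> finite (F v) \<and> card (F v) = c"
  shows "card {v @ [a] | v a. v \<in> A \<and> a \<in> F v} = card A * c"
proof -
  have "{v @ [a] | v a. v \<in> A \<and> a \<in> F v} = (\<lambda>(v, a). v @ [a]) ` Sigma A F" by auto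
  moreover have "inj_on (\<lambda>(v, a). v @ [a]) (Sigma A F)" by (auto simp: inj_on_def)
  ultimately have "card {v @ [a] | v a. v \<in> A \<and> a \<in> F v} = card (Sigma A F)"
    by (simp add: card_image)
  also have "\<dots> = (\<Sum>v\<in>A. card (F v))" using assms by (intro card_SigmaI) auto
  also have "\<dots> = card A * c" using assms(2) by simp
  finally show ?thesis .
qed

lemma consistent_words_snoc:
  "v @ [a] \<in> consistent_words k p L (Suc m) \<longleftrightarrow>
    v \<in> consistent_words k p L m \<and> a \<in> {1..k} \<and> (m < L \<longrightarrow> int a = p m)"
  unfolding consistent_words_def by (auto simp: nth_append All_less_Suc)

lemma consistent_words_SucE:
  assumes "x \<in> consistent_words k p L (Suc m)"
  obtains v a where "x = v @ [a]"
  using assms unfolding consistent_words_def by (cases x rule: rev_cases) auto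

text \<open>Truncated subtraction is intended: for \<open>m \<le> L\<close> the prefix forces the
  whole word and the count is 1.\<close>

lemma card_consistent_words:
  assumes "\<forall>t<L. p t \<in> {1..int k}"
  shows "card (consistent_words k p L m) = k ^ (m - L)"
proof (induction m)
  case 0
  have "consistent_words k p L 0 = {[]}" by (auto simp: consistent_words_def)
  then show ?case by simp
next
  case (Suc m)
  define F where "F = {a \<in> {1..k}. m < L \<longrightarrow> int a = p m}"
  have F: "F = (if m < L then {nat (p m)} else {1..k})"
    using assms by (force simp: F_def)
  have "consistent_words k p L (Suc m) =
      {v @ [a] | v a. v \<in> consistent_words k p L m \<and> a \<in> F}"
    (is "_ = ?B")
  proof (intro set_eqI iffI)
    fix x assume x: "x \<in> consistent_words k p L (Suc m)"
    then obtain v a where "x = v @ [a]" by (rule consistent_words_SucE)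
    then show "x \<in> ?B" using x unfolding F_def by (auto simp: consistent_words_snoc)
  qed (auto simp: F_def consistent_words_snoc)
  also have "card \<dots> = card (consistent_words k p L m) * (if m < L then 1 else k)"
    by (rule card_snoc_extensions) (auto simp: finite_consistent_words F)
  finally show ?case using Suc.IH by (auto simp: Suc_diff_le)
qed

text \<open>Induction on the length \<open>s\<close> built so far, with the shift
  \<open>m - j\<close> held fixed. At \<open>s = j\<close> the copying condition is vacuous because
  \<open>j \<le> m - j\<close>, which leaves the unbordered words; every further letter has
  \<open>ext_factor\<close> many choices, the same number for each word built so far.\<close>

lemma card_border_extensions:
  assumes p: "\<forall>t<L. p t \<in> {1..int k}" and jm: "2 * j \<le> m" and j1: "1 \<le> j"
    and s: "j \<le> s" "s \<le> m"
  shows "card {v \<in> consistent_words k p L s. \<not> bordered (take j v) \<and>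
            (\<forall>t<s. m - j \<le> t \<longrightarrow> v ! t = v ! (t - (m - j)))} =
         unbordered_count k p L j * (\<Prod>t=j..<s. ext_factor k p L (m - j) t)"
  using s
proof (induction s rule: dec_induct)
  case base
  have "{v \<in> consistent_words k p L j. \<not> bordered (take j v) \<and>
            (\<forall>t<j. m - j \<le> t \<longrightarrow> v ! t = v ! (t - (m - j)))} =
        {v \<in> consistent_words k p L j. \<not> bordered v}"
    using jm by (auto simp: consistent_words_def)
  then show ?case by (simp add: unbordered_count_def)
next
  case (step s)
  define d where "d = m - j"
  \<comment> \<open>A positive shift puts position \<open>s - d\<close> strictly before
    \<open>s\<close>, so the letter to be copied already exists.\<close>
  have d: "d \<ge> 1" using jm j1 d_def by auto
  define Y where "Y s = {v \<in> consistent_words k p L s. \<not> bordered (take j v) \<and>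
            (\<forall>t<s. d \<le> t \<longrightarrow> v ! t = v ! (t - d))}" for s
  define F where "F v = {a \<in> {1..k}. (s < L \<longrightarrow> int a = p s) \<and> (d \<le> s \<longrightarrow> a = v ! (s - d))}" for v
  have snoc: "v @ [a] \<in> Y (Suc s) \<longleftrightarrow> v \<in> Y s \<and> a \<in> F v" for v a
  proof (cases "length v = s")
    case True
    have "0 < s" using step.hyps j1 by simp
    then have e: "(v @ [a]) ! (t - d) = v ! (t - d)" if "t < Suc s" for t
      using that d True by (subst nth_append_left) auto
    have e': "(v @ [a]) ! s = a" using True by (metis nth_append_length)
    have "(\<forall>t<s. d \<le> t \<longrightarrow> (v @ [a]) ! t = (v @ [a]) ! (t - d)) \<longleftrightarrow>
        (\<forall>t<s. d \<le> t \<longrightarrow> v ! t = v ! (t - d))"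
      using e True by (simp add: nth_append_left)
    then have "(\<forall>t<Suc s. d \<le> t \<longrightarrow> (v @ [a]) ! t = (v @ [a]) ! (t - d)) \<longleftrightarrow>
        (d \<le> s \<longrightarrow> a = v ! (s - d)) \<and> (\<forall>t<s. d \<le> t \<longrightarrow> v ! t = v ! (t - d))"
      unfolding All_less_Suc using e[of s] e' by simp
    moreover have "take j (v @ [a]) = take j v" using True step.hyps by simp
    ultimately show ?thesis
      by (simp only: Y_def F_def mem_Collect_eq consistent_words_snoc conj_ac)
  qed (auto simp: Y_def consistent_words_def)
  have "Y (Suc s) = {v @ [a] | v a. v \<in> Y s \<and> a \<in> F v}"
  proof (intro set_eqI iffI)
    fix x assume x: "x \<in> Y (Suc s)"
    then obtain v a where "x = v @ [a]" unfolding Y_def by (blast elim: consistent_words_SucE)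
    then show "x \<in> {v @ [a] | v a. v \<in> Y s \<and> a \<in> F v}" using x snoc by blast
  qed (use snoc in blast)
  moreover have "card {v @ [a] | v a. v \<in> Y s \<and> a \<in> F v} = card (Y s) * ext_factor k p L d s"
  proof (rule card_snoc_extensions)
    show "finite (Y s)" unfolding Y_def using finite_consistent_words by simp
    fix v assume "v \<in> Y s"
    then have v: "v \<in> consistent_words k p L s" unfolding Y_def by blast
    have vk: "v ! (s - d) \<in> {1..k}" if "d \<le> s"
    proof -
      have "s - d < length v" using v d that step.hyps j1 unfolding consistent_words_def by auto
      then have "v ! (s - d) \<in> set v" by simp
      then show ?thesis using v unfolding consistent_words_def by auto
    qed
    have vp: "int (v ! (s - d)) = p (s - d)" if "d \<le> s" "s < L"
      using v that d step.hyps j1 unfolding consistent_words_def by auto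
    have ps: "p s \<in> {1..int k}" if "s < L" using p that by blast
    \<comment> \<open>For \<open>d \<le> s\<close> and \<open>s < L\<close> the copied letter lies
      in the prefix too (\<open>vp\<close>), so the test compares two values of \<open>p\<close> and
      does not depend on \<open>v\<close>.\<close>
    have "F v = (if s < L then (if s < d \<or> p s = p (s - d) then {nat (p s)} else {})
                 else if s < d then {1..k} else {v ! (s - d)})"
      using vk vp ps unfolding F_def by (auto simp: not_less)
    then show "finite (F v) \<and> card (F v) = ext_factor k p L d s"
      by (simp add: ext_factor_def)
  qed
  moreover have "card (Y s) = unbordered_count k p L j * (\<Prod>t=j..<s. ext_factor k p L d t)"
    using step unfolding Y_def d_def by simp
  ultimately have "card (Y (Suc s)) =
      unbordered_count k p L j * (\<Prod>t=j..<Suc s. ext_factor k p L d t)"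
    using step.hyps by (simp add: prod.atLeastLessThan_Suc)
  then show ?case unfolding Y_def d_def .
qed

lemma card_shortest_border_length:
  assumes p: "\<forall>t<L. p t \<in> {1..int k}" and j: "j \<in> {1..m div 2}"
  shows "card {v \<in> consistent_words k p L m. border_len v j \<and> \<not> bordered (take j v)} =
         unbordered_count k p L j * (\<Prod>t=j..<m. ext_factor k p L (m - j) t)"
proof -
  have jm: "2 * j \<le> m" "1 \<le> j" "j \<le> m" using j by auto
  have "border_len v j \<longleftrightarrow> (\<forall>t<m. m - j \<le> t \<longrightarrow> v ! t = v ! (t - (m - j)))"
    if l: "length v = m" for v
  proof
    assume b: "border_len v j"
    show "\<forall>t<m. m - j \<le> t \<longrightarrow> v ! t = v ! (t - (m - j))"
    proof (intro allI impI)
      fix t assume t: "t < m" "m - j \<le> t"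
      then have "t - (m - j) < j" using jm by auto
      then have "v ! (t - (m - j)) = v ! (length v - j + (t - (m - j)))"
        using b unfolding border_len_def by blast
      then show "v ! t = v ! (t - (m - j))" using t l by simp
    qed
  next
    assume r: "\<forall>t<m. m - j \<le> t \<longrightarrow> v ! t = v ! (t - (m - j))"
    show "border_len v j"
      unfolding border_len_def
    proof (intro conjI allI impI)
      show "1 \<le> j" "j < length v" using jm l by auto
      fix t assume "t < j"
      then show "v ! t = v ! (length v - j + t)" using r[rule_format, of "m - j + t"] l jm by auto
    qed
  qed
  then have "{v \<in> consistent_words k p L m. border_len v j \<and> \<not> bordered (take j v)} =
    {v \<in> consistent_words k p L m. \<not> bordered (take j v) \<and>
            (\<forall>t<m. m - j \<le> t \<longrightarrow> v ! t = v ! (t - (m - j)))}"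
    by (auto simp: consistent_words_def)
  then show ?thesis using card_border_extensions[OF p jm(1,2) jm(3)] by simp
qed

lemma card_bordered_consistent_words:
  assumes "\<forall>t<L. p t \<in> {1..int k}"
  shows "card {v \<in> consistent_words k p L m. bordered v} =
    (\<Sum>j=1..m div 2. unbordered_count k p L j * (\<Prod>t=j..<m. ext_factor k p L (m - j) t))"
proof -
  let ?X = "\<lambda>j. {v \<in> consistent_words k p L m. border_len v j \<and> \<not> bordered (take j v)}"
  have "{v \<in> consistent_words k p L m. bordered v} = (\<Union>j\<in>{1..m div 2}. ?X j)"
  proof -
    have "bordered v \<longleftrightarrow> (\<exists>j\<in>{1..m div 2}. border_len v j \<and> \<not> bordered (take j v))"
      if "v \<in> consistent_words k p L m" for v
      using bordered_iff_short_unbordered_border[of v] that by (simp only: consistent_words_def mem_Collect_eq)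
    then show ?thesis by blast
  qed
  also have "card \<dots> = (\<Sum>j\<in>{1..m div 2}. card (?X j))"
    by (rule card_UN_disjoint) (auto simp: finite_consistent_words dest: unbordered_border_unique)
  finally show ?thesis using card_shortest_border_length[OF assms] by simp
qed

lemma card_bordered_plus_unbordered:
  assumes "\<forall>t<L. p t \<in> {1..int k}"
  shows "card {v \<in> consistent_words k p L m. bordered v} + unbordered_count k p L m = k ^ (m - L)"
proof -
  have "consistent_words k p L m =
      {v \<in> consistent_words k p L m. bordered v} \<union> {v \<in> consistent_words k p L m. \<not> bordered v}"
    by auto
  then have "card (consistent_words k p L m) =
      card {v \<in> consistent_words k p L m. bordered v} + unbordered_count k p L m"
    unfolding unbordered_count_def
    by (subst card_Un_disjoint[symmetric]) (auto simp: finite_consistent_words)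
  then show ?thesis using card_consistent_words[OF assms] by simp
qed

text \<open>This is the form that the machine evaluates, over \<open>int\<close> because it
  subtracts in registers. Every \<open>j\<close> in the sum is below \<open>m\<close>, so a table
  filled in increasing order of \<open>m\<close> suffices.\<close>

lemma unbordered_count_rec:
  assumes "\<forall>t<L. p t \<in> {1..int k}"
  shows "int (unbordered_count k p L m) = int k ^ (m - L) -
    (\<Sum>j=1..m div 2. int (unbordered_count k p L j) * (\<Prod>t=j..<m. int (ext_factor k p L (m - j) t)))"
proof -
  have "int (card {v \<in> consistent_words k p L m. bordered v}) + int (unbordered_count k p L m)
      = int k ^ (m - L)"
    using card_bordered_plus_unbordered[OF assms, of m] by (metis of_nat_add of_nat_power)
  then show ?thesis using card_bordered_consistent_words[OF assms, of m] by simp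
qed

section \<open>Ranks\<close>

text \<open>\<open>Q\<close> is a parameter because the letter search compares three such counts:
  letter equal to, below, or at least a candidate.\<close>

definition bordered_from :: "nat \<Rightarrow> nat \<Rightarrow> (nat \<Rightarrow> int) \<Rightarrow> nat \<Rightarrow> (int \<Rightarrow> bool) \<Rightarrow> nat list set" where
  "bordered_from n k p l Q =
    {v \<in> bordered_words n k. (\<forall>t<l. int (v ! t) = p t) \<and> Q (int (v ! l))}"

text \<open>Here \<open>i\<close> is the first position at which a word departs from
  \<open>p\<close>. The cardinality is the share of the rank used up by the first \<open>l\<close>
  choices; for \<open>l = n\<close> these are all words lexicographically below the chosen
  one.\<close>

definition bordered_below :: "nat \<Rightarrow> nat \<Rightarrow> (nat \<Rightarrow> int) \<Rightarrow> nat \<Rightarrow> nat list set" where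
  "bordered_below n k p l =
    {v \<in> bordered_words n k. \<exists>i<l. (\<forall>t<i. int (v ! t) = p t) \<and> int (v ! i) < p i}"

lemma finite_bordered_words: "finite (bordered_words n k)"
  unfolding bordered_words_def
  by (rule finite_subset[OF _ finite_lists_length_eq[of "{1..k}" n]]) auto

lemma bordered_consistent_eq:
  assumes "L \<le> n"
  shows "{v \<in> consistent_words k p L n. bordered v} = {v \<in> bordered_words n k. \<forall>t<L. int (v ! t) = p t}"
  using assms by (auto simp: consistent_words_def bordered_words_def)

lemma card_bordered_from_split:
  "card (bordered_from n k p l (\<lambda>x. c \<le> x)) =
   card (bordered_from n k p l (\<lambda>x. x = c)) + card (bordered_from n k p l (\<lambda>x. c + 1 \<le> x))"
proof -
  have "bordered_from n k p l (\<lambda>x. c \<le> x) =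
      bordered_from n k p l (\<lambda>x. x = c) \<union> bordered_from n k p l (\<lambda>x. c + 1 \<le> x)"
    unfolding bordered_from_def by auto
  moreover have "bordered_from n k p l (\<lambda>x. x = c) \<inter> bordered_from n k p l (\<lambda>x. c + 1 \<le> x) = {}"
    unfolding bordered_from_def by auto
  ultimately show ?thesis
    by (simp add: card_Un_disjoint bordered_from_def finite_bordered_words)
qed

lemma card_bordered_from_less_split:
  "card (bordered_from n k p l (\<lambda>x. x < c + 1)) =
   card (bordered_from n k p l (\<lambda>x. x = c)) + card (bordered_from n k p l (\<lambda>x. x < c))"
proof -
  have "bordered_from n k p l (\<lambda>x. x < c + 1) =
      bordered_from n k p l (\<lambda>x. x = c) \<union> bordered_from n k p l (\<lambda>x. x < c)"
    unfolding bordered_from_def by auto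
  moreover have "bordered_from n k p l (\<lambda>x. x = c) \<inter> bordered_from n k p l (\<lambda>x. x < c) = {}"
    unfolding bordered_from_def by auto
  ultimately show ?thesis
    by (simp add: card_Un_disjoint bordered_from_def finite_bordered_words)
qed

lemma card_bordered_below_Suc:
  "card (bordered_below n k p (Suc l)) =
   card (bordered_below n k p l) + card (bordered_from n k p l (\<lambda>x. x < p l))"
proof -
  have "bordered_below n k p (Suc l) = bordered_below n k p l \<union> bordered_from n k p l (\<lambda>x. x < p l)"
    unfolding bordered_from_def bordered_below_def by (auto simp: less_Suc_eq)
  moreover have "bordered_below n k p l \<inter> bordered_from n k p l (\<lambda>x. x < p l) = {}"
    unfolding bordered_from_def bordered_below_def by fastforce
  ultimately show ?thesis
    by (simp add: card_Un_disjoint bordered_from_def bordered_below_def finite_bordered_words)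
qed

lemma bordered_from_eq:
  "bordered_from n k p l (\<lambda>x. x = p l) = {v \<in> bordered_words n k. \<forall>t<Suc l. int (v ! t) = p t}"
  unfolding bordered_from_def by (auto simp: less_Suc_eq)

lemma bordered_from_positive:
  assumes "l < n"
  shows "bordered_from n k p l (\<lambda>x. 1 \<le> x) = {v \<in> bordered_words n k. \<forall>t<l. int (v ! t) = p t}"
    and "bordered_from n k p l (\<lambda>x. x < 1) = {}"
proof -
  have "1 \<le> v ! l" if "v \<in> bordered_words n k" for v
    using that assms unfolding bordered_words_def by (auto dest!: subsetD[OF _ nth_mem])
  then show "bordered_from n k p l (\<lambda>x. 1 \<le> x) = {v \<in> bordered_words n k. \<forall>t<l. int (v ! t) = p t}"
    and "bordered_from n k p l (\<lambda>x. x < 1) = {}"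
    unfolding bordered_from_def by force+
qed

text \<open>Keeps the letter search within the alphabet: while some word remains, the next candidate
  is at most \<open>k\<close>.\<close>

lemma bordered_from_letter_bound:
  assumes "l < n" "1 \<le> card (bordered_from n k p l (\<lambda>x. c \<le> x))"
  shows "c \<le> int k"
proof -
  obtain v where v: "v \<in> bordered_from n k p l (\<lambda>x. c \<le> x)"
    using assms(2) by (metis card.empty equals0I not_one_le_zero)
  then have "v ! l \<le> k"
    using assms(1) unfolding bordered_from_def bordered_words_def by (auto dest!: subsetD[OF _ nth_mem])
  then show ?thesis using v unfolding bordered_from_def by auto
qed

text \<open>The prefix is read from memory, whose other cells keep changing; together with
  \<open>bordered_below_cong\<close> this carries counts over to a later memory with the same first
  \<open>l\<close> letters.\<close>

lemma bordered_from_cong: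
  assumes "\<And>t. t < l \<Longrightarrow> p t = q t"
  shows "bordered_from n k p l Q = bordered_from n k q l Q"
  using assms unfolding bordered_from_def by auto

lemma bordered_below_cong:
  assumes "\<And>t. t < l \<Longrightarrow> p t = q t"
  shows "bordered_below n k p l = bordered_below n k q l"
  using assms unfolding bordered_below_def by (auto; metis less_trans)

text \<open>Fixing all \<open>n\<close> letters leaves at most one word, so the bounds force
  \<open>r = 1\<close>; this 1 is the \<open>+ 1\<close> in \<open>rank_bordered\<close>.\<close>

lemma rank_of_full_prefix:
  assumes "r \<ge> 1" "r \<le> card {v \<in> bordered_words n k. \<forall>t<n. int (v ! t) = p t}"
  obtains w where "w \<in> bordered_words n k" "\<forall>t<n. int (w ! t) = p t"
    "rank_bordered n k w = r + card (bordered_below n k p n)"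
proof -
  have "{v \<in> bordered_words n k. \<forall>t<n. int (v ! t) = p t} \<noteq> {}"
    using assms by (metis card.empty le_trans not_one_le_zero)
  then obtain w where w: "w \<in> bordered_words n k" "\<forall>t<n. int (w ! t) = p t" by blast
  have len: "length v = n" if "v \<in> bordered_words n k" for v
    using that by (simp add: bordered_words_def)
  have "v = w" if "v \<in> bordered_words n k" "\<forall>t<n. int (v ! t) = p t" for v
    using w that len by (intro nth_equalityI) (auto, metis of_nat_eq_iff)
  then have "{v \<in> bordered_words n k. \<forall>t<n. int (v ! t) = p t} = {w}" using w by blast
  then have "r = 1" using assms by simp
  have "lex_less v w \<longleftrightarrow> (\<exists>i<n. (\<forall>t<i. int (v ! t) = p t) \<and> int (v ! i) < p i)"
    if v: "v \<in> bordered_words n k" for v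
  proof -
    \<comment> \<open>For words of equal length the proper-prefix case of \<open>lexord\<close>
      cannot occur.\<close>
    have "lex_less v w \<longleftrightarrow> (\<exists>i<n. take i v = take i w \<and> v ! i < w ! i)"
      unfolding lex_less_def lexord_take_index_conv using len[OF v] len[OF w(1)] by simp
    also have "\<dots> \<longleftrightarrow> (\<exists>i<n. (\<forall>t<i. int (v ! t) = p t) \<and> int (v ! i) < p i)"
    proof (intro ex_cong1 conj_cong refl)
      fix i assume i: "i < n"
      have "take i v = take i w \<longleftrightarrow> (\<forall>t<i. v ! t = w ! t)"
        using len[OF v] len[OF w(1)] i by (simp add: list_eq_iff_nth_eq)
      also have "\<dots> \<longleftrightarrow> (\<forall>t<i. int (v ! t) = p t)"
        using w(2) i by (metis less_trans of_nat_eq_iff)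
      finally show "take i v = take i w \<longleftrightarrow> (\<forall>t<i. int (v ! t) = p t)" .
      show "v ! i < w ! i \<longleftrightarrow> int (v ! i) < p i" using w(2) i by (metis of_nat_less_iff)
    qed
    finally show ?thesis .
  qed
  then have "{v \<in> bordered_words n k. lex_less v w} = bordered_below n k p n"
    unfolding bordered_below_def by blast
  then show thesis using that[OF w] \<open>r = 1\<close> unfolding rank_bordered_def by simp
qed

section \<open>Structured programs for the machine\<close>

datatype com =
    Skip
  | Do instr
  | Seq com com (infixr ";;" 60)
  | Cond nat com com
  | While nat com

fun com_len :: "com \<Rightarrow> nat" where
  "com_len Skip = 0"
| "com_len (Do a) = 1"
| "com_len (c ;; c') = com_len c + com_len c'"
| "com_len (Cond x c c') = com_len c + com_len c' + 2"
| "com_len (While x c) = com_len c + 2"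

text \<open>The first argument is the address at which the code will sit, because jump targets are
  absolute.\<close>

fun compile :: "nat \<Rightarrow> com \<Rightarrow> prog" where
  "compile b Skip = []"
| "compile b (Do a) = [a]"
| "compile b (c ;; c') = compile b c @ compile (b + com_len c) c'"
| "compile b (Cond x c c') =
    Jz x (b + com_len c + 2) # compile (b + 1) c @
    Jmp (b + com_len c + com_len c' + 2) # compile (b + com_len c + 2) c'"
| "compile b (While x c) = Jz x (b + com_len c + 2) # compile (b + 1) c @ [Jmp b]"

lemma length_compile [simp]: "length (compile b c) = com_len c"
  by (induction c arbitrary: b) auto

fun code_at :: "prog \<Rightarrow> nat \<Rightarrow> instr list \<Rightarrow> bool" where
  "code_at P b [] \<longleftrightarrow> True"
| "code_at P b (a # as) \<longleftrightarrow> b < length P \<and> P ! b = a \<and> code_at P (Suc b) as"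

lemma code_at_append: "code_at P b (xs @ ys) \<longleftrightarrow> code_at P b xs \<and> code_at P (b + length xs) ys"
  by (induction xs arbitrary: b) auto

lemma code_at_suffix: "code_at (pre @ xs) (length pre) xs"
proof (induction xs arbitrary: pre)
  case (Cons a xs)
  from Cons[of "pre @ [a]"] show ?case by simp
qed simp

text \<open>A precondition for running a command from memory m at time \<^term>\<open>\<tau>\<close> while accessing only cells
  below S. Since time increases strictly, the bound B on the time at the loop head ensures
  termination.\<close>

fun vc :: "nat \<Rightarrow> com \<Rightarrow> ((nat \<Rightarrow> int) \<Rightarrow> nat \<Rightarrow> bool) \<Rightarrow> (nat \<Rightarrow> int) \<Rightarrow> nat \<Rightarrow> bool" where
  "vc S Skip Q m \<tau> \<longleftrightarrow> Q m \<tau>"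
| "vc S (Do (Const i v)) Q m \<tau> \<longleftrightarrow> i < S \<and> Q (m(i := v)) (Suc \<tau>)"
| "vc S (Do (Add i j l)) Q m \<tau> \<longleftrightarrow> i < S \<and> j < S \<and> l < S \<and> Q (m(i := m j + m l)) (Suc \<tau>)"
| "vc S (Do (Sub i j l)) Q m \<tau> \<longleftrightarrow> i < S \<and> j < S \<and> l < S \<and> Q (m(i := m j - m l)) (Suc \<tau>)"
| "vc S (Do (Mul i j l)) Q m \<tau> \<longleftrightarrow> i < S \<and> j < S \<and> l < S \<and> Q (m(i := m j * m l)) (Suc \<tau>)"
| "vc S (Do (Div i j l)) Q m \<tau> \<longleftrightarrow> i < S \<and> j < S \<and> l < S \<and> Q (m(i := m j div m l)) (Suc \<tau>)"
| "vc S (Do (Mod i j l)) Q m \<tau> \<longleftrightarrow> i < S \<and> j < S \<and> l < S \<and> Q (m(i := m j mod m l)) (Suc \<tau>)"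
| "vc S (Do (Load i j)) Q m \<tau> \<longleftrightarrow>
    i < S \<and> j < S \<and> nat (m j) < S \<and> Q (m(i := m (nat (m j)))) (Suc \<tau>)"
| "vc S (Do (Store i j)) Q m \<tau> \<longleftrightarrow>
    i < S \<and> j < S \<and> nat (m i) < S \<and> Q (m(nat (m i) := m j)) (Suc \<tau>)"
| "vc S (Do (Jz i t)) Q m \<tau> \<longleftrightarrow> False"
| "vc S (Do (Jmp t)) Q m \<tau> \<longleftrightarrow> False"
| "vc S (Do Halt) Q m \<tau> \<longleftrightarrow> False"
| "vc S (c ;; c') Q m \<tau> \<longleftrightarrow> vc S c (vc S c' Q) m \<tau>"
| "vc S (Cond x c c') Q m \<tau> \<longleftrightarrow> x < S \<and>
    (if m x = 0 then vc S c' Q m (Suc \<tau>) else vc S c (\<lambda>m \<tau>. Q m (Suc \<tau>)) m (Suc \<tau>))"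
| "vc S (While x c) Q m \<tau> \<longleftrightarrow> x < S \<and> (\<exists>I B. I m \<tau> \<and> (\<forall>m \<tau>. I m \<tau> \<longrightarrow> \<tau> \<le> B \<and>
    (if m x = 0 then Q m (Suc \<tau>) else vc S c (\<lambda>m \<tau>. I m (Suc \<tau>)) m (Suc \<tau>))))"

section \<open>Soundness of the preconditions\<close>

definition runs_to :: "prog \<Rightarrow> config \<Rightarrow> nat \<Rightarrow> config \<Rightarrow> bool" where
  "runs_to P x t y \<longleftrightarrow> (step P ^^ t) x = y"

lemma runs_to_0: "runs_to P x 0 x"
  by (simp add: runs_to_def)

lemma runs_to_trans: "runs_to P x t y \<Longrightarrow> runs_to P y t' z \<Longrightarrow> runs_to P x (t + t') z"
  by (auto simp: runs_to_def add.commute[of t] funpow_add)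

lemma runs_to_step:
  assumes "b < length P" "P ! b = a" "a \<noteq> Halt"
  shows "runs_to P (b, m, T) (Suc 0) (exec a (b, m, T))"
  using assms by (simp add: runs_to_def step_def halted_def)

text \<open>Stated for any address \<open>b\<close> and any set \<open>T\<close> of touched cells,
  so that pieces compose. Execution ends just behind the code; for a whole program this is past the
  last instruction, which counts as halted.\<close>

lemma vc_sound:
  assumes "vc S c Q m \<tau>" "code_at P b (compile b c)" "T \<subseteq> {..<S}"
  shows "\<exists>t m' T'. runs_to P (b, m, T) t (b + com_len c, m', T') \<and> T' \<subseteq> {..<S} \<and> Q m' (\<tau> + t)"
  using assms
proof (induction c arbitrary: Q m \<tau> b T)
  case Skip
  then have "runs_to P (b, m, T) 0 (b + com_len Skip, m, T) \<and> T \<subseteq> {..<S} \<and> Q m (\<tau> + 0)"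
    by (simp add: runs_to_0)
  then show ?case by blast
next
  case (Do a)
  have r: "a \<noteq> Halt \<Longrightarrow> runs_to P (b, m, T) (Suc 0) (exec a (b, m, T))"
    using Do.prems by (intro runs_to_step) auto
  obtain b' m' T' where e: "exec a (b, m, T) = (b', m', T')" by (metis prod_cases3)
  have "a \<noteq> Halt \<and> b' = Suc b \<and> T' \<subseteq> {..<S} \<and> Q m' (Suc \<tau>)"
    using Do.prems e by (cases a) auto
  then have "runs_to P (b, m, T) (Suc 0) (b + com_len (Do a), m', T') \<and> T' \<subseteq> {..<S} \<and> Q m' (\<tau> + Suc 0)"
    using r e by simp
  then show ?case by blast
next
  case (Seq c c')
  from Seq.prems have v: "vc S c (vc S c' Q) m \<tau>" and c: "code_at P b (compile b c)"
    and c': "code_at P (b + com_len c) (compile (b + com_len c) c')"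
    by (auto simp: code_at_append)
  from Seq.IH(1)[OF v c Seq.prems(3)] obtain t1 m1 T1 where
    1: "runs_to P (b, m, T) t1 (b + com_len c, m1, T1)" "T1 \<subseteq> {..<S}" "vc S c' Q m1 (\<tau> + t1)"
    by blast
  from Seq.IH(2)[OF 1(3) c' 1(2)] obtain t2 m2 T2 where
    2: "runs_to P (b + com_len c, m1, T1) t2 (b + com_len c + com_len c', m2, T2)"
    "T2 \<subseteq> {..<S}" "Q m2 (\<tau> + t1 + t2)"
    by blast
  from runs_to_trans[OF 1(1) 2(1)] 2 show ?case by (auto simp: add.assoc)
next
  case (Cond x c c')
  let ?e = "b + com_len c + com_len c' + 2"
  from Cond.prems have code: "b < length P" "P ! b = Jz x (b + com_len c + 2)"
    "code_at P (b + 1) (compile (b + 1) c)"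
    "b + com_len c + 1 < length P" "P ! (b + com_len c + 1) = Jmp ?e"
    "code_at P (b + com_len c + 2) (compile (b + com_len c + 2) c')" and x: "x < S"
    by (auto simp: code_at_append)
  have s1: "runs_to P (b, m, T) (Suc 0) (if m x = 0 then b + com_len c + 2 else b + 1, m, insert x T)"
    using runs_to_step[OF code(1,2), of m T] by (simp split: if_split_asm)
  have T: "insert x T \<subseteq> {..<S}" using x Cond.prems by auto
  show ?case
  proof (cases "m x = 0")
    case True
    then have "vc S c' Q m (Suc \<tau>)" using Cond.prems by simp
    from Cond.IH(2)[OF this code(6) T] obtain t2 m2 T2 where
      2: "runs_to P (b + com_len c + 2, m, insert x T) t2 (b + com_len c + 2 + com_len c', m2, T2)"
      "T2 \<subseteq> {..<S}" "Q m2 (Suc \<tau> + t2)" by blast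
    have "runs_to P (b, m, T) (Suc 0 + t2) (b + com_len c + 2 + com_len c', m2, T2)"
      by (rule runs_to_trans[OF _ 2(1)]) (use s1 True in simp)
    then show ?thesis using 2 by (intro exI[of _ "Suc 0 + t2"]) (auto simp: ac_simps)
  next
    case False
    then have "vc S c (\<lambda>m \<tau>. Q m (Suc \<tau>)) m (Suc \<tau>)" using Cond.prems by simp
    from Cond.IH(1)[OF this code(3) T] obtain t2 m2 T2 where
      2: "runs_to P (b + 1, m, insert x T) t2 (b + 1 + com_len c, m2, T2)"
      "T2 \<subseteq> {..<S}" "Q m2 (Suc (Suc \<tau> + t2))" by blast
    have 3: "runs_to P (b + 1 + com_len c, m2, T2) (Suc 0) (?e, m2, T2)"
      using runs_to_step[OF code(4,5), of m2 T2] by (simp add: ac_simps)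
    have "runs_to P (b, m, T) (Suc 0 + (t2 + Suc 0)) (?e, m2, T2)"
      by (rule runs_to_trans[OF _ runs_to_trans[OF 2(1) 3]]) (use s1 False in simp)
    then show ?thesis using 2 by (intro exI[of _ "Suc 0 + (t2 + Suc 0)"]) (auto simp: ac_simps)
  qed
next
  case (While x c)
  from While.prems have code: "b < length P" "P ! b = Jz x (b + com_len c + 2)"
    "code_at P (b + 1) (compile (b + 1) c)"
    "b + com_len c + 1 < length P" "P ! (b + com_len c + 1) = Jmp b" and x: "x < S"
    by (auto simp: code_at_append)
  from While.prems(1) obtain I B where I0: "I m \<tau>"
    and I: "\<And>m \<tau>. I m \<tau> \<Longrightarrow> \<tau> \<le> B \<and>
      (if m x = 0 then Q m (Suc \<tau>) else vc S c (\<lambda>m \<tau>. I m (Suc \<tau>)) m (Suc \<tau>))"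
    by auto
  show ?case using I0 While.prems(3)
  \<comment> \<open>The invariant permits \<open>\<tau> = B\<close>, and the truncated difference
    must still decrease then; hence \<open>Suc B\<close>.\<close>
  proof (induction "Suc B - \<tau>" arbitrary: m \<tau> T rule: less_induct)
    case less
    have s1: "runs_to P (b, m, T) (Suc 0) (if m x = 0 then b + com_len c + 2 else b + 1, m, insert x T)"
      using runs_to_step[OF code(1,2), of m T] by (simp split: if_split_asm)
    have T: "insert x T \<subseteq> {..<S}" using x less.prems by auto
    show ?case
    proof (cases "m x = 0")
      case True
      then show ?thesis using s1 T I[OF less.prems(1)] by (intro exI[of _ "Suc 0"]) auto
    next
      case False
      then have "vc S c (\<lambda>m \<tau>. I m (Suc \<tau>)) m (Suc \<tau>)" using I[OF less.prems(1)] by simp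
      from While.IH[OF this code(3) T] obtain t2 m2 T2 where
        2: "runs_to P (b + 1, m, insert x T) t2 (b + 1 + com_len c, m2, T2)"
        "T2 \<subseteq> {..<S}" "I m2 (Suc (Suc \<tau> + t2))" by blast
      have 3: "runs_to P (b + 1 + com_len c, m2, T2) (Suc 0) (b, m2, T2)"
        using runs_to_step[OF code(4,5), of m2 T2] by (simp add: ac_simps)
      have 4: "runs_to P (b, m, T) (Suc 0 + (t2 + Suc 0)) (b, m2, T2)"
        by (rule runs_to_trans[OF _ runs_to_trans[OF 2(1) 3]]) (use s1 False in simp)
      have "Suc B - Suc (Suc \<tau> + t2) < Suc B - \<tau>"
        using I[OF less.prems(1)] by auto
      from less.hyps[OF this 2(3) 2(2)] obtain t3 m3 T3 where
        5: "runs_to P (b, m2, T2) t3 (b + com_len (While x c), m3, T3)" "T3 \<subseteq> {..<S}"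
        "Q m3 (Suc (Suc \<tau> + t2) + t3)" by blast
      from runs_to_trans[OF 4 5(1)] 5 show ?thesis
        by (intro exI[of _ "Suc 0 + (t2 + Suc 0) + t3"]) (auto simp: ac_simps)
    qed
  qed
qed

lemma vc_mono:
  assumes "vc S c Q m \<tau>" "\<And>m \<tau>. Q m \<tau> \<Longrightarrow> Q' m \<tau>"
  shows "vc S c Q' m \<tau>"
  using assms
proof (induction c arbitrary: Q Q' m \<tau>)
  case (Do a)
  then show ?case by (cases a) auto
next
  case (Seq c c')
  from Seq.prems(1) have "vc S c (vc S c' Q) m \<tau>" by simp
  then have "vc S c (vc S c' Q') m \<tau>"
    by (rule Seq.IH(1)) (use Seq.IH(2) Seq.prems(2) in blast)
  then show ?case by simp
next
  case (Cond x c c')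
  then show ?case
    using Cond.IH(1)[of "\<lambda>m \<tau>. Q m (Suc \<tau>)" m "Suc \<tau>" "\<lambda>m \<tau>. Q' m (Suc \<tau>)"]
      Cond.IH(2)[of Q m "Suc \<tau>" Q'] by auto
next
  case (While x c)
  from While.prems(1) obtain I B where "x < S" "I m \<tau>"
    and I: "\<And>m \<tau>. I m \<tau> \<Longrightarrow> \<tau> \<le> B \<and>
      (if m x = 0 then Q m (Suc \<tau>) else vc S c (\<lambda>m \<tau>. I m (Suc \<tau>)) m (Suc \<tau>))"
    by auto
  moreover have "\<tau> \<le> B \<and>
      (if m x = 0 then Q' m (Suc \<tau>) else vc S c (\<lambda>m \<tau>. I m (Suc \<tau>)) m (Suc \<tau>))"
    if "I m \<tau>" for m \<tau>
    using I[OF that] While.prems(2) by presburger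
  ultimately show ?case unfolding vc.simps by blast
qed simp

text \<open>The number \<open>i\<close> of completed rounds lets an invariant bound the clock by a
  multiple of \<open>i\<close>. It is hidden by an existential quantifier to fit
  \<open>vc\<close>.\<close>

lemma vc_WhileI:
  assumes "x < S" "I 0 m \<tau>"
    "\<And>i m \<tau>. I i m \<tau> \<Longrightarrow> m x \<noteq> 0 \<Longrightarrow> vc S c (\<lambda>m \<tau>. I (Suc i) m (Suc \<tau>)) m (Suc \<tau>)"
    "\<And>i m \<tau>. I i m \<tau> \<Longrightarrow> m x = 0 \<Longrightarrow> Q m (Suc \<tau>)"
    "\<And>i m \<tau>. I i m \<tau> \<Longrightarrow> \<tau> \<le> B"
  shows "vc S (While x c) Q m \<tau>"
proof -
  define J where "J m \<tau> \<longleftrightarrow> (\<exists>i. I i m \<tau>)" for m \<tau>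
  have "vc S c (\<lambda>m \<tau>. J m (Suc \<tau>)) m (Suc \<tau>)" if "J m \<tau>" "m x \<noteq> 0" for m \<tau>
    using that assms(3) vc_mono unfolding J_def by (metis (mono_tags, lifting))
  moreover have "J m \<tau>" using assms(2) J_def by blast
  moreover have "\<tau> \<le> B" "m x = 0 \<longrightarrow> Q m (Suc \<tau>)" if "J m \<tau>" for m \<tau>
    using that assms(4,5) unfolding J_def by blast+
  ultimately have "J m \<tau> \<and> (\<forall>m \<tau>. J m \<tau> \<longrightarrow> \<tau> \<le> B \<and>
      (if m x = 0 then Q m (Suc \<tau>) else vc S c (\<lambda>m \<tau>. J m (Suc \<tau>)) m (Suc \<tau>)))"
    by simp
  then show ?thesis unfolding vc.simps using assms(1) by blast
qed

text \<open>The loop equation asks for an invariant that simplification cannot guess. Without it,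
  \<open>simp\<close> runs through straight-line code and branches and leaves loops folded.\<close>

declare vc.simps(15) [simp del]

section \<open>The unranking program\<close>

text \<open>
  Register use: 0 the remaining rank, 1 n, 2 k, 3 the prefix length L, 4 the word length m,
  5 the border length j, 6 the position t, 7 the product for G(m, j), 8 the value U(m),
  9 the power of k, 12 the constant 1, 13 the current letter, 15 the offset m - j, 16 the constant
  24, 17 the value 24 + n, 20 the value m div 2; 10, 11, 14, 21 and 22 are loop guards and 18, 19
  are scratch. The word is kept in the cells from 24 on and U(j) in cell 24 + n + j, so cell
  24 + n stays 0 and terminates the word. Comparisons a < b with b > 0 are tested as a div b = 0.
\<close>

definition ext_loop :: com where
  "ext_loop = While 11 (
     Do (Div 18 6 3) ;;
     Cond 18 (Do (Div 18 6 15) ;; Cond 18 Skip (Do (Mul 7 7 2)))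
       (Do (Div 18 6 15) ;;
        Cond 18 (Do (Add 18 16 6) ;; Do (Load 19 18) ;; Do (Sub 18 18 15) ;; Do (Load 18 18) ;;
               Do (Sub 18 18 19) ;; Cond 18 (Do (Const 7 0)) Skip)
          Skip) ;;
     Do (Add 6 6 12) ;; Do (Sub 11 4 6))"

text \<open>The product is accumulated onto the entry value of register 7, so that entering with
  U(j) yields the whole summand. A disagreement sets the register to 0, where it stays. A budget of
  20 steps per round is generous.\<close>

lemma ext_loop_spec:
  assumes regs: "m 2 = int k" "m 3 = int L" "m 4 = int M" "m 6 = int j" "m 11 = int M - int j"
      "m 12 = 1" "m 15 = int d" "m 16 = 24"
    and bounds: "1 \<le> L" "1 \<le> d" "j \<le> M" "M \<le> n" "24 + n < S"
    and word: "\<And>t. t < n \<Longrightarrow> m (24 + t) = p t"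
  shows "vc S ext_loop (\<lambda>m' \<tau>'.
      m' 7 = m 7 * (\<Prod>t=j..<M. int (ext_factor k p L d t)) \<and>
      (\<forall>a. a \<notin> {6, 7, 11, 18, 19} \<longrightarrow> m' a = m a) \<and> \<tau>' \<le> \<tau> + 20 * n + 1) m \<tau>"
  unfolding ext_loop_def
proof (rule vc_WhileI[where B = "\<tau> + 20 * n" and I = "\<lambda>i m' \<tau>'.
      j + i \<le> M \<and> m' 6 = int (j + i) \<and> m' 11 = int M - int (j + i) \<and>
      m' 7 = m 7 * (\<Prod>t=j..<j + i. int (ext_factor k p L d t)) \<and>
      (\<forall>a. a \<notin> {6, 7, 11, 18, 19} \<longrightarrow> m' a = m a) \<and> \<tau>' \<le> \<tau> + 20 * i"])
  fix i m' \<tau>'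
  assume I: "j + i \<le> M \<and> m' 6 = int (j + i) \<and> m' 11 = int M - int (j + i) \<and>
      m' 7 = m 7 * (\<Prod>t=j..<j + i. int (ext_factor k p L d t)) \<and>
      (\<forall>a. a \<notin> {6, 7, 11, 18, 19} \<longrightarrow> m' a = m a) \<and> \<tau>' \<le> \<tau> + 20 * i"
    and "m' 11 \<noteq> 0"
  define t where "t = j + i"
  have t: "t < M" using I \<open>m' 11 \<noteq> 0\<close> t_def by auto
  have fr: "\<And>a. a \<notin> {6, 7, 11, 18, 19} \<Longrightarrow> m' a = m a" using I by blast
  have r: "m' 2 = int k" "m' 3 = int L" "m' 4 = int M" "m' 6 = int t" "m' 12 = 1" "m' 15 = int d"
    "m' 16 = 24" using I fr regs by (auto simp: t_def)
  have dv: "int t div int L = 0 \<longleftrightarrow> t < L" "int t div int d = 0 \<longleftrightarrow> t < d"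
    using bounds by (auto simp flip: zdiv_int simp: div_eq_0_iff)
  have ad: "nat (24 + int t) = 24 + t" by simp
  define u where "u = t - d"
  have ad': "nat (24 + int t - int d) = 24 + u" "24 + u < S" if "\<not> t < d"
    using that t bounds unfolding u_def by auto
  have tn: "t < n" "\<not> t < d \<Longrightarrow> u < n" using t bounds u_def by auto
  have ef: "ext_factor k p L d t =
      (if t < L then (if t < d \<or> p t = p u then 1 else 0) else if t < d then k else 1)"
    by (simp add: ext_factor_def u_def)
  have jt: "j \<le> t" by (simp add: t_def)
  show "vc S
     (Do (Div 18 6 3) ;;
     Cond 18 (Do (Div 18 6 15) ;; Cond 18 Skip (Do (Mul 7 7 2)))
       (Do (Div 18 6 15) ;;
        Cond 18 (Do (Add 18 16 6) ;; Do (Load 19 18) ;; Do (Sub 18 18 15) ;; Do (Load 18 18) ;;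
               Do (Sub 18 18 19) ;; Cond 18 (Do (Const 7 0)) Skip)
          Skip) ;;
     Do (Add 6 6 12) ;; Do (Sub 11 4 6))
   (\<lambda>m' \<tau>'. j + Suc i \<le> M \<and> m' 6 = int (j + Suc i) \<and> m' 11 = int M - int (j + Suc i) \<and>
      m' 7 = m 7 * (\<Prod>t=j..<j + Suc i. int (ext_factor k p L d t)) \<and>
      (\<forall>a. a \<notin> {6, 7, 11, 18, 19} \<longrightarrow> m' a = m a) \<and> Suc \<tau>' \<le> \<tau> + 20 * Suc i) m' (Suc \<tau>')"
    using I t bounds(3-) jt
    \<comment> \<open>The cases are the paths through the branches; the copied position
      \<open>u\<close> is consulted only where \<open>d \<le> t\<close>.\<close>
    by (cases "t < L"; cases "t < d"; cases "p t = p u")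
       (simp_all add: r dv ad ad' word tn ef t_def[symmetric] flip: u_def)
next
  fix i m' \<tau>'
  assume I: "j + i \<le> M \<and> m' 6 = int (j + i) \<and> m' 11 = int M - int (j + i) \<and>
      m' 7 = m 7 * (\<Prod>t=j..<j + i. int (ext_factor k p L d t)) \<and>
      (\<forall>a. a \<notin> {6, 7, 11, 18, 19} \<longrightarrow> m' a = m a) \<and> \<tau>' \<le> \<tau> + 20 * i"
    and "m' 11 = 0"
  then have "j + i = M" by linarith
  then show "m' 7 = m 7 * (\<Prod>t=j..<M. int (ext_factor k p L d t)) \<and>
      (\<forall>a. a \<notin> {6, 7, 11, 18, 19} \<longrightarrow> m' a = m a) \<and> Suc \<tau>' \<le> \<tau> + 20 * n + 1"
    using I bounds by auto
qed (use assms in auto)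

text \<open>Multiplying by register 12, which holds 1, serves as a register move, for which there is
  no instruction.\<close>

definition border_loop :: com where
  "border_loop = While 10 (
     Do (Add 5 5 12) ;; Do (Sub 15 4 5) ;; Do (Add 18 17 5) ;; Do (Load 7 18) ;;
     Do (Mul 6 5 12) ;; Do (Sub 11 4 6) ;; ext_loop ;; Do (Sub 8 8 7) ;; Do (Sub 10 20 5))"

text \<open>The table \<open>U\<close> is arbitrary, and only entries below \<open>M\<close> are
  assumed, since entry \<open>M\<close> is the one under computation.\<close>

lemma border_loop_spec:
  assumes regs: "m 2 = int k" "m 3 = int L" "m 4 = int M" "m 5 = 0" "m 10 = int (M div 2)"
      "m 12 = 1" "m 16 = 24" "m 17 = 24 + int n" "m 20 = int (M div 2)"
    and bounds: "1 \<le> L" "M \<le> n" "24 + 2 * n < S"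
    and word: "\<And>t. t < n \<Longrightarrow> m (24 + t) = p t"
    and table: "\<And>j. 1 \<le> j \<Longrightarrow> j < M \<Longrightarrow> m (24 + n + j) = U j"
  shows "vc S border_loop (\<lambda>m' \<tau>'.
      m' 8 = m 8 - (\<Sum>j=1..M div 2. U j * (\<Prod>t=j..<M. int (ext_factor k p L (M - j) t))) \<and>
      (\<forall>a. a \<notin> {5, 6, 7, 8, 10, 11, 15, 18, 19} \<longrightarrow> m' a = m a) \<and>
      \<tau>' \<le> \<tau> + 40 * n * n + 1) m \<tau>"
  unfolding border_loop_def
proof (rule vc_WhileI[where B = "\<tau> + 40 * n * n" and I = "\<lambda>i m' \<tau>'.
      i \<le> M div 2 \<and> m' 5 = int i \<and> m' 10 = int (M div 2) - int i \<and>
      m' 8 = m 8 - (\<Sum>j=1..i. U j * (\<Prod>t=j..<M. int (ext_factor k p L (M - j) t))) \<and>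
      (\<forall>a. a \<notin> {5, 6, 7, 8, 10, 11, 15, 18, 19} \<longrightarrow> m' a = m a) \<and> \<tau>' \<le> \<tau> + 40 * n * i"])
  fix i m' \<tau>'
  assume I: "i \<le> M div 2 \<and> m' 5 = int i \<and> m' 10 = int (M div 2) - int i \<and>
      m' 8 = m 8 - (\<Sum>j=1..i. U j * (\<Prod>t=j..<M. int (ext_factor k p L (M - j) t))) \<and>
      (\<forall>a. a \<notin> {5, 6, 7, 8, 10, 11, 15, 18, 19} \<longrightarrow> m' a = m a) \<and> \<tau>' \<le> \<tau> + 40 * n * i"
    and "m' 10 \<noteq> 0"
  then have i: "i < M div 2" by auto
  have fr: "\<And>a. a \<notin> {5, 6, 7, 8, 10, 11, 15, 18, 19} \<Longrightarrow> m' a = m a" using I by blast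
  have r: "m' 2 = int k" "m' 3 = int L" "m' 4 = int M" "m' 5 = int i" "m' 12 = 1"
    "m' 16 = 24" "m' 17 = 24 + int n" "m' 20 = int (M div 2)" using I fr regs by auto
  have ad: "nat (25 + (int n + int i)) = 25 + (n + i)" by simp
  have tab: "m' (24 + n + Suc i) = U (Suc i)" using fr table[of "Suc i"] i by simp
  have wd: "m' (24 + t) = p t" if "t < n" for t using fr word that by simp
  have Mi: "int M - (int i + 1) = int (M - Suc i)" using i by simp
  define Q where "Q = (\<lambda>m' \<tau>'. Suc i \<le> M div 2 \<and> m' 5 = int (Suc i) \<and>
      m' 10 = int (M div 2) - int (Suc i) \<and>
      m' 8 = m 8 - (\<Sum>j=1..Suc i. U j * (\<Prod>t=j..<M. int (ext_factor k p L (M - j) t))) \<and>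
      (\<forall>a. a \<notin> {5, 6, 7, 8, 10, 11, 15, 18, 19} \<longrightarrow> m' a = m a) \<and>
      Suc \<tau>' \<le> \<tau> + 40 * n * Suc i)"
  let ?m1 = "m'(5 := int i + 1, 15 := int (M - Suc i), 18 := 25 + (int n + int i), 7 := U (Suc i),
          6 := int i + 1, 11 := int (M - Suc i))"
  have "vc S ext_loop (vc S (Do (Sub 8 8 7) ;; Do (Sub 10 20 5)) Q) ?m1
      (Suc (Suc (Suc (Suc (Suc (Suc (Suc \<tau>')))))))"
  \<comment> \<open>Subgoals 1 to 14 are the premises of \<open>ext_loop_spec\<close>, left to the
    closing \<open>qed\<close>; subgoal 15 is the continuation after the loop. The later loops
    follow the same pattern.\<close>
  proof (rule vc_mono[OF ext_loop_spec[where k = k and L = L and M = M and j = "Suc i"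
          and d = "M - Suc i" and n = n and p = p]], goal_cases)
    case (15 m2 \<tau>2)
    have m27: "m2 7 = U (Suc i) * (\<Prod>t=Suc i..<M. int (ext_factor k p L (M - Suc i) t))"
      and fr1: "\<And>a. a \<notin> {6, 7, 11, 18, 19} \<Longrightarrow> m2 a = ?m1 a" and t2: "\<tau>2 \<le> \<tau>' + 20 * n + 8"
      using 15 by auto
    have m2: "m2 5 = int i + 1" "m2 20 = int (M div 2)" "m2 8 = m' 8"
      by (simp_all add: fr1 r)
    have fr2: "m2 a = m a" if "a \<notin> {5, 6, 7, 8, 10, 11, 15, 18, 19}" for a
      using fr1[of a] fr[of a] that by simp
    \<comment> \<open>A round takes place only if \<open>M div 2 > 0\<close>, so
      \<open>n \<ge> 2\<close> and the second \<open>20 * n\<close> pays for the instructions around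
      the inner loop.\<close>
    have time: "\<tau>2 + 3 \<le> \<tau> + 40 * n * Suc i"
    proof -
      have "40 * n * Suc i = 40 * n * i + 40 * n" "2 \<le> n" using i bounds by auto
      then show ?thesis using I t2 by linarith
    qed
    define m3 where "m3 = m2(8 := m2 8 - m2 7, 10 := int (M div 2) - (int i + 1))"
    have "Q m3 (Suc (Suc \<tau>2))"
      unfolding Q_def
    proof (intro conjI)
      show "m3 8 = m 8 - (\<Sum>j=1..Suc i. U j * (\<Prod>t=j..<M. int (ext_factor k p L (M - j) t)))"
        using I m2(3) m27 by (simp add: m3_def)
      show "\<forall>a. a \<notin> {5, 6, 7, 8, 10, 11, 15, 18, 19} \<longrightarrow> m3 a = m a"
        using fr2 by (simp add: m3_def)
      show "Suc (Suc (Suc \<tau>2)) \<le> \<tau> + 40 * n * Suc i" using time by linarith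
    qed (use i m2(1) in \<open>auto simp: m3_def\<close>)
    then show ?case using bounds m2(1,2) by (simp add: m3_def)
  qed (use r wd i bounds in auto)
  then have "vc S (Do (Add 5 5 12) ;; Do (Sub 15 4 5) ;; Do (Add 18 17 5) ;; Do (Load 7 18) ;;
     Do (Mul 6 5 12) ;; Do (Sub 11 4 6) ;; ext_loop ;; Do (Sub 8 8 7) ;; Do (Sub 10 20 5)) Q
     m' (Suc \<tau>')"
    using bounds i tab div_le_dividend[of M 2] by (simp add: r ad Mi del: of_nat_diff)
  then show "vc S (Do (Add 5 5 12) ;; Do (Sub 15 4 5) ;; Do (Add 18 17 5) ;; Do (Load 7 18) ;;
     Do (Mul 6 5 12) ;; Do (Sub 11 4 6) ;; ext_loop ;; Do (Sub 8 8 7) ;; Do (Sub 10 20 5))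
   (\<lambda>m' \<tau>'. Suc i \<le> M div 2 \<and> m' 5 = int (Suc i) \<and> m' 10 = int (M div 2) - int (Suc i) \<and>
      m' 8 = m 8 - (\<Sum>j=1..Suc i. U j * (\<Prod>t=j..<M. int (ext_factor k p L (M - j) t))) \<and>
      (\<forall>a. a \<notin> {5, 6, 7, 8, 10, 11, 15, 18, 19} \<longrightarrow> m' a = m a) \<and>
      Suc \<tau>' \<le> \<tau> + 40 * n * Suc i) m' (Suc \<tau>')"
    unfolding Q_def .
next
  fix i m' \<tau>'
  assume I: "i \<le> M div 2 \<and> m' 5 = int i \<and> m' 10 = int (M div 2) - int i \<and>
      m' 8 = m 8 - (\<Sum>j=1..i. U j * (\<Prod>t=j..<M. int (ext_factor k p L (M - j) t))) \<and>
      (\<forall>a. a \<notin> {5, 6, 7, 8, 10, 11, 15, 18, 19} \<longrightarrow> m' a = m a) \<and> \<tau>' \<le> \<tau> + 40 * n * i"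
  have "i \<le> n" using I bounds by auto
  then have "40 * n * i \<le> 40 * n * n" by (intro mult_le_mono) auto
  then show "\<tau>' \<le> \<tau> + 40 * n * n" using I by linarith
  moreover assume "m' 10 = 0"
  then have "i = M div 2" using I by linarith
  ultimately show "m' 8 = m 8 - (\<Sum>j=1..M div 2. U j * (\<Prod>t=j..<M. int (ext_factor k p L (M - j) t))) \<and>
      (\<forall>a. a \<notin> {5, 6, 7, 8, 10, 11, 15, 18, 19} \<longrightarrow> m' a = m a) \<and>
      Suc \<tau>' \<le> \<tau> + 40 * n * n + 1"
    using I by auto
qed (use assms in auto)


definition count_loop :: com where
  "count_loop = Do (Const 4 0) ;; Do (Const 9 1) ;; Do (Mul 22 1 12) ;;
   While 22 (
     Do (Div 18 4 3) ;; Cond 18 (Do (Mul 9 9 2)) Skip ;;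
     Do (Add 4 4 12) ;; Do (Mul 8 9 12) ;; Do (Const 5 0) ;; Do (Add 18 12 12) ;;
     Do (Div 20 4 18) ;; Do (Mul 10 20 12) ;; border_loop ;;
     Do (Add 18 17 4) ;; Do (Store 18 8) ;; Do (Sub 22 1 4))"

text \<open>The table is rebuilt for each prefix, so the frame protects the word and the registers
  of the outer loops but not the table. The count is left as the difference of registers 9 and 8,
  that is \<open>k ^ (n - L)\<close> minus U(n).\<close>

lemma count_loop_spec:
  assumes regs: "m 1 = int n" "m 2 = int k" "m 3 = int L" "m 12 = 1" "m 16 = 24" "m 17 = 24 + int n"
    and bounds: "1 \<le> L" "1 \<le> n" "24 + 2 * n < S"
    and word: "\<And>t. t < n \<Longrightarrow> m (24 + t) = p t"
    and letters: "\<forall>t<L. p t \<in> {1..int k}"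
  shows "vc S count_loop (\<lambda>m' \<tau>'.
      m' 9 - m' 8 = int (card {v \<in> consistent_words k p L n. bordered v}) \<and>
      (\<forall>a. a \<in> {0, 1, 2, 3, 12, 13, 14, 16, 17, 21} \<or> 24 \<le> a \<and> a \<le> 24 + n \<longrightarrow> m' a = m a) \<and>
      \<tau>' \<le> \<tau> + 60 * n ^ 3 + 4) m \<tau>"
proof -
  let ?U = "\<lambda>j. int (unbordered_count k p L j)"
  let ?frame = "\<lambda>m'. \<forall>a. a \<in> {0, 1, 2, 3, 12, 13, 14, 16, 17, 21} \<or> 24 \<le> a \<and> a \<le> 24 + n \<longrightarrow> m' a = m a"
  let ?I = "\<lambda>i m' \<tau>'. i \<le> n \<and> m' 4 = int i \<and> m' 9 = int k ^ (i - L) \<and> m' 22 = int n - int i \<and>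
      (\<forall>j. 1 \<le> j \<longrightarrow> j \<le> i \<longrightarrow> m' (24 + n + j) = ?U j) \<and> (1 \<le> i \<longrightarrow> m' 8 = ?U i) \<and> ?frame m' \<and>
      \<tau>' \<le> \<tau> + 3 + 60 * n ^ 2 * i"
  let ?body = "Do (Div 18 4 3) ;; Cond 18 (Do (Mul 9 9 2)) Skip ;;
     Do (Add 4 4 12) ;; Do (Mul 8 9 12) ;; Do (Const 5 0) ;; Do (Add 18 12 12) ;;
     Do (Div 20 4 18) ;; Do (Mul 10 20 12) ;; border_loop ;;
     Do (Add 18 17 4) ;; Do (Store 18 8) ;; Do (Sub 22 1 4)"
  let ?Q = "\<lambda>m' \<tau>'. m' 9 - m' 8 = int (card {v \<in> consistent_words k p L n. bordered v}) \<and> ?frame m' \<and>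
      \<tau>' \<le> \<tau> + 60 * n ^ 3 + 4"
  have "vc S (While 22 ?body) ?Q (m(4 := 0, 9 := 1, 22 := int n)) (Suc (Suc (Suc \<tau>)))"
  proof (rule vc_WhileI[where B = "\<tau> + 60 * n ^ 3 + 3" and I = ?I])
    fix i m' \<tau>'
    assume I: "?I i m' \<tau>'" and "m' 22 \<noteq> 0"
    then have i: "i < n" by auto
    have fr: "\<And>a. a \<in> {0, 1, 2, 3, 12, 13, 14, 16, 17, 21} \<or> 24 \<le> a \<and> a \<le> 24 + n \<Longrightarrow> m' a = m a"
      using I by blast
    have r: "m' 1 = int n" "m' 2 = int k" "m' 3 = int L" "m' 4 = int i" "m' 12 = 1"
      "m' 16 = 24" "m' 17 = 24 + int n" "m' 9 = int k ^ (i - L)" using I fr regs by auto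
    have tab: "\<And>j. 1 \<le> j \<Longrightarrow> j \<le> i \<Longrightarrow> m' (24 + n + j) = ?U j" using I by blast
    have dv: "int i div int L = 0 \<longleftrightarrow> i < L"
      using bounds by (auto simp flip: zdiv_int simp: div_eq_0_iff)
    have dv2: "(int i + 1) div 2 = int (Suc i div 2)" by (simp add: zdiv_int)
    have wd: "m' (24 + t) = p t" if "t < n" for t using fr word that by simp
    \<comment> \<open>The program tests the old length \<open>i\<close> before incrementing it: for
      \<open>i < L\<close> both exponents are 0, and from \<open>i = L\<close> on each step adds one
      factor \<open>k\<close>.\<close>
    have pw: "int k ^ (Suc i - L) = (if i < L then m' 9 else m' 9 * int k)"
      using r by (auto simp: Suc_diff_le)
    define h where "h = int (Suc i div 2)"
    define P where "P = int k ^ (Suc i - L)"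
    define Q where "Q = (\<lambda>m' \<tau>'. ?I (Suc i) m' (Suc \<tau>'))"
    \<comment> \<open>The common tail of both branches of the power update, which reach it with
      different clocks and different contents of the scratch register 18.\<close>
    have main: "vc S border_loop (vc S (Do (Add 18 17 4) ;; Do (Store 18 8) ;; Do (Sub 22 1 4)) Q)
        (m1(4 := int i + 1, 8 := P, 5 := 0, 18 := 2, 20 := h, 10 := h)) \<tau>1"
      if m1: "m1 9 = P" "\<And>a. a \<notin> {9, 18} \<Longrightarrow> m1 a = m' a" "\<tau>1 \<le> \<tau>' + 12" for m1 \<tau>1
    proof (rule vc_mono[OF border_loop_spec[where k = k and L = L and M = "Suc i" and n = n and p = p
            and U = ?U]], goal_cases)
      case (15 m2 \<tau>2)
      have fr2: "\<And>a. a \<notin> {4, 5, 6, 7, 8, 9, 10, 11, 15, 18, 19, 20} \<Longrightarrow> m2 a = m' a"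
        and m2: "m2 4 = int i + 1" "m2 9 = P" "\<tau>2 \<le> \<tau>1 + 40 * n * n + 1"
        and m28: "m2 8 = P - (\<Sum>j=1..Suc i div 2. ?U j * (\<Prod>t=j..<Suc i. int (ext_factor k p L (Suc i - j) t)))"
        using 15 m1 by auto
      have 8: "m2 8 = ?U (Suc i)" using m28 unbordered_count_rec[OF letters, of "Suc i"] P_def by simp
      have r2: "m2 17 = 24 + int n" "m2 1 = int n" using fr2 r by auto
      have ad: "nat (24 + int n + (int i + 1)) = 24 + n + Suc i" by simp
      have "n ^ 2 \<ge> 1" "40 * n * n = 40 * n ^ 2" "60 * n ^ 2 * Suc i = 60 * n ^ 2 * i + 60 * n ^ 2"
        using i by (auto simp: power2_eq_square)
      then have time: "\<tau>2 + 4 \<le> \<tau> + 3 + 60 * n ^ 2 * Suc i"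
        using m2(3) m1(3) I by linarith
      have tab2: "m2 (24 + n + j) = ?U j" if "1 \<le> j" "j \<le> i" for j using fr2 tab that by simp
      have fr3: "m2 a = m a" if "a \<in> {0, 1, 2, 3, 12, 13, 14, 16, 17, 21} \<or> 24 \<le> a \<and> a \<le> 24 + n" for a
        using fr2[of a] fr[of a] that by auto
      define m3 where "m3 = m2(18 := 24 + int n + (int i + 1), 24 + n + Suc i := m2 8,
          22 := int n - (int i + 1))"
      have "Q m3 (Suc (Suc (Suc \<tau>2)))"
        unfolding Q_def
      proof (intro conjI)
        show "\<forall>j. 1 \<le> j \<longrightarrow> j \<le> Suc i \<longrightarrow> m3 (24 + n + j) = ?U j"
          using tab2 8 by (auto simp: m3_def le_Suc_eq)
        show "?frame m3" using fr3 by (auto simp: m3_def)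
        show "Suc (Suc (Suc (Suc \<tau>2))) \<le> \<tau> + 3 + 60 * n ^ 2 * Suc i" using time by linarith
      qed (use i m2 8 in \<open>auto simp: m3_def P_def\<close>)
      then show ?case using i bounds r2 m2(1) ad by (simp add: m3_def)
    qed (use r wd tab i bounds m1 in \<open>auto simp: h_def\<close>)
    have "vc S ?body Q m' (Suc \<tau>')"
    proof (cases "i < L")
      case True
      show ?thesis using bounds main[of "m'(18 := 0)" "(Suc (Suc (Suc (Suc (Suc (Suc (Suc (Suc (Suc \<tau>')))))))))"] True pw dv2
        by (simp add: r dv P_def h_def)
    next
      case False
      show ?thesis using bounds main[of "m'(18 := int i div int L, 9 := P)" "(Suc (Suc (Suc (Suc (Suc (Suc (Suc (Suc (Suc (Suc (Suc \<tau>')))))))))))"] False pw dv2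
        by (simp add: r dv P_def h_def)
    qed
    then show "vc S ?body (\<lambda>m' \<tau>'. ?I (Suc i) m' (Suc \<tau>')) m' (Suc \<tau>')"
      unfolding Q_def .
  next
    fix i m' \<tau>'
    assume I: "?I i m' \<tau>'"
    then have "60 * n ^ 2 * i \<le> 60 * n ^ 2 * n" by (intro mult_le_mono) auto
    also have "60 * n ^ 2 * n = 60 * n ^ 3" by (simp add: power2_eq_square power3_eq_cube)
    finally show B: "\<tau>' \<le> \<tau> + 60 * n ^ 3 + 3" using I by linarith
    assume "m' 22 = 0"
    then have "i = n" using I by linarith
    then have "m' 9 - m' 8 = int (k ^ (n - L)) - ?U n" using I bounds by simp
    also have "\<dots> = int (card {v \<in> consistent_words k p L n. bordered v})"
      using card_bordered_plus_unbordered[OF letters, of n] by linarith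
    finally show "?Q m' (Suc \<tau>')" using I B by simp
  qed (use assms in auto)
  then show ?thesis unfolding count_loop_def using bounds by (simp add: regs regs(1)[simplified])
qed

section \<open>Searching for the letters of the word\<close>

definition letter_loop :: com where
  "letter_loop = While 14 (
     Do (Add 13 13 12) ;; Do (Add 18 16 3) ;; Do (Sub 18 18 12) ;; Do (Store 18 13) ;;
     count_loop ;; Do (Sub 18 9 8) ;; Do (Div 19 18 0) ;;
     Cond 19 (Do (Const 14 0)) (Do (Sub 0 0 18)))"

text \<open>Each candidate is written into the word itself, because \<open>count_loop\<close> reads
  its prefix from memory. At most \<open>k\<close> counts are made, which is where the factor
  \<open>k\<close> of the time bound comes from.\<close>

lemma letter_loop_spec:
  assumes regs: "m 0 = int r" "m 1 = int n" "m 2 = int k" "m 3 = int (Suc l)" "m 12 = 1"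
      "m 13 = 0" "m 14 = 1" "m 16 = 24" "m 17 = 24 + int n"
    and bounds: "l < n" "24 + 2 * n < S"
    and rank: "1 \<le> r" "r \<le> card (bordered_from n k p l (\<lambda>x. 1 \<le> x))"
    and word: "\<And>t. t < l \<Longrightarrow> m (24 + t) = p t"
    and letters: "\<forall>t<l. p t \<in> {1..int k}"
  shows "vc S letter_loop (\<lambda>m' \<tau>'.
      (\<exists>c r'. m' (24 + l) = int c \<and> 1 \<le> c \<and> c \<le> k \<and> m' 0 = int r' \<and> 1 \<le> r' \<and>
        r' + card (bordered_from n k p l (\<lambda>x. x < int c)) = r \<and>
        r' \<le> card (bordered_from n k p l (\<lambda>x. x = int c))) \<and>
      (\<forall>a. a \<in> {1, 2, 3, 12, 16, 17, 21} \<or> 24 \<le> a \<and> a \<le> 24 + n \<and> a \<noteq> 24 + l \<longrightarrow> m' a = m a) \<and>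
      \<tau>' \<le> \<tau> + 80 * n ^ 3 * k + 1) m \<tau>"
proof -
  define frame where "frame m' \<longleftrightarrow> (\<forall>a. a \<in> {1, 2, 3, 12, 16, 17, 21} \<or>
      24 \<le> a \<and> a \<le> 24 + n \<and> a \<noteq> 24 + l \<longrightarrow> m' a = m a)" for m' :: "nat \<Rightarrow> int"
  \<comment> \<open>While the search is on, \<open>r'\<close> is the rank of the target among the
    words with next letter at least \<open>i + 1\<close>. Register 14 is cleared in the round that
    finds the letter, so the invariant is a disjunction of \<open>live\<close> and
    \<open>found\<close>.\<close>
  define live where "live i m' \<longleftrightarrow> m' 14 = 1 \<and> m' 13 = int i \<and>
      (\<exists>r'. m' 0 = int r' \<and> 1 \<le> r' \<and>
        r' + card (bordered_from n k p l (\<lambda>x. x < int i + 1)) = r \<and>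
        r' \<le> card (bordered_from n k p l (\<lambda>x. int i + 1 \<le> x)))" for i and m' :: "nat \<Rightarrow> int"
  define found where "found m' \<longleftrightarrow>
      (\<exists>c r'. m' (24 + l) = int c \<and> 1 \<le> c \<and> c \<le> k \<and> m' 0 = int r' \<and> 1 \<le> r' \<and>
        r' + card (bordered_from n k p l (\<lambda>x. x < int c)) = r \<and>
        r' \<le> card (bordered_from n k p l (\<lambda>x. x = int c)))" for m' :: "nat \<Rightarrow> int"
  define I where "I i m' \<tau>' \<longleftrightarrow> i \<le> k \<and> (live i m' \<or> m' 14 = 0 \<and> found m') \<and> frame m' \<and>
      \<tau>' \<le> \<tau> + 80 * n ^ 3 * i" for i and m' :: "nat \<Rightarrow> int" and \<tau>'
  have n3: "1 \<le> n ^ 3" using bounds by simp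
  have "vc S letter_loop (\<lambda>m' \<tau>'. found m' \<and> frame m' \<and> \<tau>' \<le> \<tau> + 80 * n ^ 3 * k + 1) m \<tau>"
    unfolding letter_loop_def
  proof (rule vc_WhileI[where B = "\<tau> + 80 * n ^ 3 * k" and I = I])
    show "14 < S" using bounds by simp
    show "I 0 m \<tau>" using regs rank bordered_from_positive(2)[OF bounds(1), of k p]
      by (simp add: I_def live_def frame_def)
  next
    fix i m' \<tau>' assume II: "I i m' \<tau>'"
    then have "80 * n ^ 3 * i \<le> 80 * n ^ 3 * k" unfolding I_def by (intro mult_le_mono) auto
    then show B: "\<tau>' \<le> \<tau> + 80 * n ^ 3 * k" using II unfolding I_def by linarith
    assume "m' 14 = 0"
    then show "found m' \<and> frame m' \<and> Suc \<tau>' \<le> \<tau> + 80 * n ^ 3 * k + 1"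
      using II B unfolding I_def live_def by auto
  next
    fix i m' \<tau>' assume II: "I i m' \<tau>'" and "m' 14 \<noteq> 0"
    then have live: "live i m'" and frame: "frame m'" and time: "\<tau>' \<le> \<tau> + 80 * n ^ 3 * i"
      unfolding I_def by auto
    then obtain r' where r': "m' 0 = int r'" "1 \<le> r'"
        "r' + card (bordered_from n k p l (\<lambda>x. x < int i + 1)) = r"
        "r' \<le> card (bordered_from n k p l (\<lambda>x. int i + 1 \<le> x))"
      unfolding live_def by blast
    have fr: "m' a = m a" if "a \<in> {1, 2, 3, 12, 16, 17, 21} \<or> 24 \<le> a \<and> a \<le> 24 + n \<and> a \<noteq> 24 + l" for a
      using frame that unfolding frame_def by blast
    have r: "m' 1 = int n" "m' 2 = int k" "m' 3 = int (Suc l)" "m' 12 = 1" "m' 16 = 24"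
      "m' 17 = 24 + int n" using fr regs by auto
    have r13: "m' 13 = int i" "m' 14 = 1" using live unfolding live_def by auto
    have ik: "int i + 1 \<le> int k"
      by (rule bordered_from_letter_bound[OF bounds(1), of k p]) (use r' in linarith)
    let ?m1 = "m'(13 := int i + 1, 18 := 24 + int l, 24 + l := int i + 1)"
    \<comment> \<open>The prefix as \<open>count_loop\<close> sees it: \<open>p\<close> on the first
      \<open>l\<close> positions, then the candidate.\<close>
    define q where "q t = ?m1 (24 + t)" for t
    have q: "q t = p t" if "t < l" for t
      using fr word that bounds by (auto simp: q_def)
    have ql: "q l = int i + 1" by (simp add: q_def)
    have qk: "\<forall>t<Suc l. q t \<in> {1..int k}"
      using letters q ql ik by (auto simp: less_Suc_eq)
    define b where "b = card (bordered_from n k p l (\<lambda>x. x = int i + 1))"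
    have "{v \<in> consistent_words k q (Suc l) n. bordered v} = bordered_from n k q l (\<lambda>x. x = q l)"
      using bordered_consistent_eq[of "Suc l" n k q] bounds by (simp add: bordered_from_eq)
    also have "\<dots> = bordered_from n k p l (\<lambda>x. x = int i + 1)"
      unfolding ql by (rule bordered_from_cong) (rule q)
    finally have b: "card {v \<in> consistent_words k q (Suc l) n. bordered v} = b"
      unfolding b_def by simp
    have split: "card (bordered_from n k p l (\<lambda>x. int i + 1 \<le> x)) =
        b + card (bordered_from n k p l (\<lambda>x. 2 + int i \<le> x))"
      using card_bordered_from_split[of n k p l "int i + 1"] by (simp add: b_def)
    have split': "card (bordered_from n k p l (\<lambda>x. x < 2 + int i)) =
        b + card (bordered_from n k p l (\<lambda>x. x < int i + 1))"
      using card_bordered_from_less_split[of n k p l "int i + 1"] by (simp add: b_def)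
    define Q where "Q = (\<lambda>m' \<tau>'. I (Suc i) m' (Suc \<tau>'))"
    have "vc S count_loop (vc S (Do (Sub 18 9 8) ;; Do (Div 19 18 0) ;;
        Cond 19 (Do (Const 14 0)) (Do (Sub 0 0 18))) Q) ?m1 (Suc (Suc (Suc (Suc (Suc \<tau>')))))"
    proof (rule vc_mono[OF count_loop_spec[where n = n and k = k and L = "Suc l" and p = q]], goal_cases)
      case (12 m2 \<tau>2)
      have m2: "m2 9 - m2 8 = int b" and t2: "\<tau>2 \<le> (Suc (Suc (Suc (Suc (Suc \<tau>'))))) + 60 * n ^ 3 + 4"
        and fr2: "\<And>a. a \<in> {0, 1, 2, 3, 12, 13, 14, 16, 17, 21} \<or> 24 \<le> a \<and> a \<le> 24 + n \<Longrightarrow> m2 a = ?m1 a"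
        using 12 unfolding b by blast+
      have frame2: "frame (m2(18 := x, 19 := y, z := w))" if "z \<in> {0, 14}" for x y z w
        unfolding frame_def
      proof (intro allI impI)
        fix a assume a: "a \<in> {1, 2, 3, 12, 16, 17, 21} \<or> 24 \<le> a \<and> a \<le> 24 + n \<and> a \<noteq> 24 + l"
        then have "a \<notin> {0, 13, 14, 18, 19, 24 + l}" by auto
        then show "(m2(18 := x, 19 := y, z := w)) a = m a"
          using fr2[of a] fr[OF a] a that by auto
      qed
      have m20: "m2 0 = int r'" using fr2[of 0] r' by simp
      have m2': "m2 13 = int i + 1" "m2 14 = 1" "m2 (24 + l) = int i + 1"
        using fr2 bounds r13 by auto
      have "80 * n ^ 3 * Suc i = 80 * n ^ 3 * i + 80 * n ^ 3" by simp
      then have time2: "\<tau>2 + 6 \<le> \<tau> + 80 * n ^ 3 * Suc i" using time t2 n3 by linarith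
      have dv: "int b div int r' = 0 \<longleftrightarrow> b < r'"
        using r' by (auto simp flip: zdiv_int simp: div_eq_0_iff)
      \<comment> \<open>If \<open>b < r'\<close>, all \<open>b\<close> words with this letter
        precede the target and are taken off the rank; otherwise the target has this letter.\<close>
      show ?case
      proof (cases "b < r'")
        case True
        have "live (Suc i) (m2(18 := int b, 19 := 0, 0 := int r' - int b))"
          unfolding live_def
        proof (intro conjI exI[of _ "r' - b"])
          show "r' - b + card (bordered_from n k p l (\<lambda>x. x < int (Suc i) + 1)) = r"
            using split' r' True by (simp add: add.commute)
          show "r' - b \<le> card (bordered_from n k p l (\<lambda>x. int (Suc i) + 1 \<le> x))"
            using split r' True by (simp add: add.commute)
        qed (use True m2' in auto)
        then have "Q (m2(18 := int b, 19 := 0, 0 := int r' - int b)) (Suc (Suc (Suc (Suc \<tau>2))))"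
          using frame2[of 0] ik time2 by (simp add: Q_def I_def)
        then show ?thesis using bounds True dv m2 m20 by simp
      next
        case False
        have "found (m2(18 := int b, 19 := int b div int r', 14 := 0))"
          unfolding found_def
        proof (rule exI[of _ "Suc i"], rule exI[of _ r'], intro conjI)
          show "r' + card (bordered_from n k p l (\<lambda>x. x < int (Suc i))) = r"
            using r' by (simp add: add.commute)
          show "r' \<le> card (bordered_from n k p l (\<lambda>x. x = int (Suc i)))"
            using False by (simp add: b_def add.commute)
        qed (use m2' m20 r' ik in auto)
        then have "Q (m2(18 := int b, 19 := int b div int r', 14 := 0)) (Suc (Suc (Suc (Suc (Suc \<tau>2)))))"
          using frame2[of 14] ik time2 by (simp add: Q_def I_def)
        then show ?thesis using bounds False dv m2 m20 by simp
      qed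
    qed (use r bounds q_def qk in auto)
    then have "vc S (Do (Add 13 13 12) ;; Do (Add 18 16 3) ;; Do (Sub 18 18 12) ;; Do (Store 18 13) ;;
        count_loop ;; Do (Sub 18 9 8) ;; Do (Div 19 18 0) ;;
        Cond 19 (Do (Const 14 0)) (Do (Sub 0 0 18))) Q m' (Suc \<tau>')"
      using bounds by (simp add: r r13 nat_add_distrib)
    then show "vc S (Do (Add 13 13 12) ;; Do (Add 18 16 3) ;; Do (Sub 18 18 12) ;; Do (Store 18 13) ;;
        count_loop ;; Do (Sub 18 9 8) ;; Do (Div 19 18 0) ;;
        Cond 19 (Do (Const 14 0)) (Do (Sub 0 0 18))) (\<lambda>m' \<tau>'. I (Suc i) m' (Suc \<tau>')) m' (Suc \<tau>')"
      unfolding Q_def .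
  qed
  then show ?thesis unfolding found_def frame_def .
qed

definition select_loop :: com where
  "select_loop = While 21 (
     Do (Add 3 3 12) ;; Do (Const 13 0) ;; Do (Const 14 1) ;; letter_loop ;; Do (Sub 21 1 3))"

text \<open>Invariant \<open>sel\<close>: the target has the chosen prefix of length
  \<open>i\<close>, its rank among the words with that prefix is \<open>r'\<close>, and the words
  discarded as smaller account for the rest of \<open>r\<close>. At \<open>i = n\<close> this is
  \<open>rank_of_full_prefix\<close>.\<close>

lemma select_loop_spec:
  assumes regs: "m 0 = int r" "m 1 = int n" "m 2 = int k" "m 3 = 0" "m 12 = 1" "m 16 = 24"
      "m 17 = 24 + int n" "m 21 = int n" "m (24 + n) = 0"
    and bounds: "1 \<le> n" "1 \<le> k" "24 + 2 * n < S"
    and rank: "1 \<le> r" "r \<le> card (bordered_words n k)"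
  shows "vc S select_loop (\<lambda>m' \<tau>'.
      (\<exists>w \<in> bordered_words n k. rank_bordered n k w = r \<and> (\<forall>t<n. int (w ! t) = m' (24 + t))) \<and>
      m' (24 + n) = 0 \<and> \<tau>' \<le> \<tau> + 90 * n ^ 4 * k + 1) m \<tau>"
proof -
  define frame where "frame m' \<longleftrightarrow> (\<forall>a \<in> {1, 2, 12, 16, 17, 24 + n}. m' a = m a)" for m'
  define sel where "sel i m' \<longleftrightarrow> (\<forall>t<i. m' (24 + t) \<in> {1..int k}) \<and>
      (\<exists>r'. m' 0 = int r' \<and> 1 \<le> r' \<and>
        r' \<le> card {v \<in> bordered_words n k. \<forall>t<i. int (v ! t) = m' (24 + t)} \<and>
        r' + card (bordered_below n k (\<lambda>t. m' (24 + t)) i) = r)" for i m'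
  define I where "I i m' \<tau>' \<longleftrightarrow> i \<le> n \<and> m' 3 = int i \<and> m' 21 = int n - int i \<and> sel i m' \<and> frame m' \<and>
      \<tau>' \<le> \<tau> + 90 * n ^ 3 * k * i" for i and m' :: "nat \<Rightarrow> int" and \<tau>'
  have nk: "1 \<le> n ^ 3 * k" using bounds by simp
  show ?thesis
    unfolding select_loop_def
  proof (rule vc_WhileI[where B = "\<tau> + 90 * n ^ 4 * k" and I = I])
    show "21 < S" using bounds by simp
    show "I 0 m \<tau>" using regs rank by (simp add: I_def sel_def frame_def bordered_below_def)
  next
    fix i m' \<tau>' assume II: "I i m' \<tau>'"
    then have "90 * n ^ 3 * k * i \<le> 90 * n ^ 3 * k * n" unfolding I_def by (intro mult_le_mono) auto
    also have "90 * n ^ 3 * k * n = 90 * n ^ 4 * k" by (simp add: power_numeral_reduce)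
    finally show B: "\<tau>' \<le> \<tau> + 90 * n ^ 4 * k" using II unfolding I_def by linarith
    assume "m' 21 = 0"
    then have "i = n" using II unfolding I_def by linarith
    then obtain r' where r': "1 \<le> r'"
        "r' \<le> card {v \<in> bordered_words n k. \<forall>t<n. int (v ! t) = m' (24 + t)}"
        "r' + card (bordered_below n k (\<lambda>t. m' (24 + t)) n) = r"
      using II unfolding I_def sel_def by blast
    from rank_of_full_prefix[OF r'(1,2)] r'(3)
    have "\<exists>w \<in> bordered_words n k. rank_bordered n k w = r \<and> (\<forall>t<n. int (w ! t) = m' (24 + t))"
      by metis
    then show "(\<exists>w \<in> bordered_words n k. rank_bordered n k w = r \<and> (\<forall>t<n. int (w ! t) = m' (24 + t))) \<and>
      m' (24 + n) = 0 \<and> Suc \<tau>' \<le> \<tau> + 90 * n ^ 4 * k + 1"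
      using B II regs unfolding I_def frame_def by simp
  next
    fix i m' \<tau>' assume II: "I i m' \<tau>'" and "m' 21 \<noteq> 0"
    then have i: "i < n" unfolding I_def by auto
    have fr: "m' a = m a" if "a \<in> {1, 2, 12, 16, 17, 24 + n}" for a
      using II that unfolding I_def frame_def by blast
    have r: "m' 1 = int n" "m' 2 = int k" "m' 3 = int i" "m' 12 = 1" "m' 16 = 24" "m' 17 = 24 + int n"
      using fr regs II unfolding I_def by auto
    define p where "p t = m' (24 + t)" for t
    from II obtain r' where r': "m' 0 = int r'" "1 \<le> r'"
        "r' \<le> card {v \<in> bordered_words n k. \<forall>t<i. int (v ! t) = p t}"
        "r' + card (bordered_below n k p i) = r" and letters: "\<forall>t<i. p t \<in> {1..int k}"
      unfolding I_def sel_def p_def by blast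
    define Q where "Q = (\<lambda>m' \<tau>'. I (Suc i) m' (Suc \<tau>'))"
    let ?m1 = "m'(3 := int i + 1, 13 := 0, 14 := 1)"
    have "vc S letter_loop (vc S (Do (Sub 21 1 3)) Q) ?m1 (Suc (Suc (Suc (Suc \<tau>'))))"
    proof (rule vc_mono[OF letter_loop_spec[where r = r' and n = n and k = k and l = i and p = p]], goal_cases)
      case (16 m2 \<tau>2)
      then obtain c r2 where c: "m2 (24 + i) = int c" "1 \<le> c" "c \<le> k" "m2 0 = int r2" "1 \<le> r2"
          "r2 + card (bordered_from n k p i (\<lambda>x. x < int c)) = r'"
          "r2 \<le> card (bordered_from n k p i (\<lambda>x. x = int c))"
        by blast
      have fr2: "m2 a = ?m1 a" if "a \<in> {1, 2, 3, 12, 16, 17, 21} \<or> 24 \<le> a \<and> a \<le> 24 + n \<and> a \<noteq> 24 + i" for a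
        using 16 that by blast
      have t2: "\<tau>2 \<le> (Suc (Suc (Suc (Suc \<tau>')))) + 80 * n ^ 3 * k + 1" using 16 by blast
      define q where "q t = m2 (24 + t)" for t
      have q: "q t = p t" if "t < i" for t using fr2 that i by (simp add: q_def p_def)
      have qi: "q i = int c" using c by (simp add: q_def)
      have f: "bordered_from n k p i R = bordered_from n k q i R" for R
        by (rule bordered_from_cong) (simp add: q)
      have g: "bordered_below n k p i = bordered_below n k q i"
        by (rule bordered_below_cong) (simp add: q)
      define m3 where "m3 = m2(21 := int n - (int i + 1))"
      have m3q: "m3 (24 + t) = q t" for t by (simp add: m3_def q_def)
      have "sel (Suc i) m3"
        unfolding sel_def m3q
      proof (intro conjI exI[of _ r2])
        show "\<forall>t<Suc i. q t \<in> {1..int k}" using letters q qi c by (auto simp: less_Suc_eq)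
        show "r2 \<le> card {v \<in> bordered_words n k. \<forall>t<Suc i. int (v ! t) = q t}"
          using c(7) by (simp only: f bordered_from_eq flip: qi)
        show "r2 + card (bordered_below n k q (Suc i)) = r"
          using c(6) r'(4) by (simp add: f g card_bordered_below_Suc qi)
      qed (use c in \<open>auto simp: m3_def\<close>)
      moreover have "frame m3" using fr2 fr i by (auto simp: frame_def m3_def)
      moreover have m23: "m2 3 = int i + 1" "m2 1 = int n" using fr2 r by auto
      moreover have "Suc (Suc \<tau>2) \<le> \<tau> + 90 * n ^ 3 * k * Suc i"
      proof -
        have "90 * n ^ 3 * k * Suc i = 90 * n ^ 3 * k * i + 90 * (n ^ 3 * k)"
          "80 * n ^ 3 * k = 80 * (n ^ 3 * k)" by simp_all
        then show ?thesis using II t2 nk unfolding I_def by linarith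
      qed
      ultimately have "Q m3 (Suc \<tau>2)" using i by (simp add: Q_def I_def m3_def)
      then show ?case using m23 bounds by (simp add: m3_def)
    qed (use r r' i bounds letters bordered_from_positive(1)[OF i, of k p] in \<open>auto simp: p_def\<close>)
    then have "vc S (Do (Add 3 3 12) ;; Do (Const 13 0) ;; Do (Const 14 1) ;; letter_loop ;; Do (Sub 21 1 3))
        Q m' (Suc \<tau>')"
      using bounds by (simp add: r)
    then show "vc S (Do (Add 3 3 12) ;; Do (Const 13 0) ;; Do (Const 14 1) ;; letter_loop ;; Do (Sub 21 1 3))
        (\<lambda>m' \<tau>'. I (Suc i) m' (Suc \<tau>')) m' (Suc \<tau>')"
      unfolding Q_def .
  qed
qed

text \<open>The output overwrites the registers from cell 3 on, so the copying uses only cells 0, 1, 2 and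
  stops at the zero cell after the word. As 3 + t < 24 + t, no letter is overwritten before it is
  copied.\<close>

definition copy_loop :: com where
  "copy_loop = Do (Const 0 24) ;; Do (Load 1 0) ;;
   While 1 (Do (Const 2 21) ;; Do (Sub 2 0 2) ;; Do (Store 2 1) ;; Do (Const 2 1) ;;
     Do (Add 0 0 2) ;; Do (Load 1 0))"

lemma copy_loop_spec:
  assumes "\<And>t. t < n \<Longrightarrow> m (24 + t) \<noteq> 0" "m (24 + n) = 0" "24 + 2 * n < S"
  shows "vc S copy_loop (\<lambda>m' \<tau>'. (\<forall>t<n. m' (3 + t) = m (24 + t)) \<and> \<tau>' \<le> \<tau> + 8 * n + 3) m \<tau>"
proof -
  let ?I = "\<lambda>i m' \<tau>'. i \<le> n \<and> m' 0 = 24 + int i \<and> m' 1 = m (24 + i) \<and> (\<forall>a\<ge>24 + i. m' a = m a) \<and>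
      (\<forall>t<i. m' (3 + t) = m (24 + t)) \<and> \<tau>' \<le> \<tau> + 2 + 8 * i"
  let ?body = "Do (Const 2 21) ;; Do (Sub 2 0 2) ;; Do (Store 2 1) ;; Do (Const 2 1) ;;
     Do (Add 0 0 2) ;; Do (Load 1 0)"
  let ?Q = "\<lambda>m' \<tau>'. (\<forall>t<n. m' (3 + t) = m (24 + t)) \<and> \<tau>' \<le> \<tau> + 8 * n + 3"
  have "vc S (While 1 ?body) ?Q (m(0 := 24, 1 := m 24)) (Suc (Suc \<tau>))"
  proof (rule vc_WhileI[where B = "\<tau> + 2 + 8 * n" and I = ?I])
    fix i m' \<tau>' assume I: "?I i m' \<tau>'" and nz: "m' 1 \<noteq> 0"
    then have i: "i < n" using assms(2) by (cases "i = n") auto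
    define Q where "Q = (\<lambda>m' \<tau>'. ?I (Suc i) m' (Suc \<tau>'))"
    \<comment> \<open>The constant 21 in the program is 24 - 3: it turns the source address
      \<open>24 + i\<close> into the target \<open>3 + i\<close>.\<close>
    define m3 where "m3 = m'(2 := 1, 3 + i := m' 1, 0 := 25 + int i, 1 := m (25 + i))"
    have "Q m3 (Suc (Suc (Suc (Suc (Suc (Suc (Suc \<tau>')))))))"
      unfolding Q_def
    proof (intro conjI)
      show "\<forall>a\<ge>24 + Suc i. m3 a = m a" using I by (auto simp: m3_def)
      show "\<forall>t<Suc i. m3 (3 + t) = m (24 + t)" using I by (auto simp: m3_def less_Suc_eq)
    qed (use I i in \<open>auto simp: m3_def\<close>)
    moreover have "m' (25 + i) = m (25 + i)" "nat (3 + int i) = 3 + i" "nat (25 + int i) = 25 + i"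
      using I by auto
    moreover have "m' 0 = 24 + int i" using I by blast
    ultimately have "vc S ?body Q m' (Suc \<tau>')"
      using i assms(3) by (simp add: m3_def fun_upd_twist)
    then show "vc S ?body (\<lambda>m' \<tau>'. ?I (Suc i) m' (Suc \<tau>')) m' (Suc \<tau>')"
      unfolding Q_def .
  next
    fix i m' \<tau>' assume I: "?I i m' \<tau>'" and "m' 1 = 0"
    then have "i = n" using assms(1)[of i] by (cases "i < n") auto
    then show "?Q m' (Suc \<tau>')" using I by simp
  qed (use assms in auto)
  then show ?thesis unfolding copy_loop_def using assms(3) by simp
qed

section \<open>The complete program and its resource bounds\<close>

definition unrank :: com where
  "unrank = Do (Const 12 1) ;; Do (Const 16 24) ;; Do (Add 17 16 1) ;; Do (Const 3 0) ;;
     Do (Mul 21 1 12) ;; select_loop ;; copy_loop"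

lemma unrank_spec:
  assumes "1 \<le> n" "1 \<le> k" "1 \<le> r" "r \<le> card (bordered_words n k)" "24 + 2 * n < S"
  shows "vc S unrank (\<lambda>m' \<tau>'.
      (\<exists>w \<in> bordered_words n k. rank_bordered n k w = r \<and> (\<forall>t<n. m' (3 + t) = int (w ! t))) \<and>
      \<tau>' \<le> 110 * n ^ 4 * k) ((\<lambda>_. 0)(0 := int r, 1 := int n, 2 := int k)) 0"
proof -
  define Q where "Q = (\<lambda>(m' :: nat \<Rightarrow> int) \<tau>'.
      (\<exists>w \<in> bordered_words n k. rank_bordered n k w = r \<and> (\<forall>t<n. m' (3 + t) = int (w ! t))) \<and>
      \<tau>' \<le> 110 * n ^ 4 * k)"
  let ?m = "(\<lambda>_. 0 :: int)(0 := int r, 1 := int n, 2 := int k, 12 := 1, 16 := 24, 17 := 24 + int n,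
      3 := 0, 21 := int n)"
  have "vc S select_loop (vc S copy_loop Q) ?m (Suc (Suc (Suc (Suc (Suc 0)))))"
  proof (rule vc_mono[OF select_loop_spec[where r = r and n = n and k = k]], goal_cases)
    case (15 m2 \<tau>2)
    then obtain w where w: "w \<in> bordered_words n k" "rank_bordered n k w = r"
        "\<forall>t<n. int (w ! t) = m2 (24 + t)" and z: "m2 (24 + n) = 0"
      and t2: "\<tau>2 \<le> 5 + 90 * n ^ 4 * k + 1" by auto
    \<comment> \<open>Letters start at 1, so copying cannot mistake a letter for the terminating
      0.\<close>
    have "w ! t \<noteq> 0" if "t < n" for t
      using w(1) that unfolding bordered_words_def by (auto dest!: subsetD[OF _ nth_mem])
    then have nz: "m2 (24 + t) \<noteq> 0" if "t < n" for t using w(3) that by (metis of_nat_eq_0_iff)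
    show ?case
    proof (rule vc_mono[OF copy_loop_spec[where m = m2 and n = n, OF nz z assms(5)]])
      fix m3 \<tau>3
      assume 3: "(\<forall>t<n. m3 (3 + t) = m2 (24 + t)) \<and> \<tau>3 \<le> \<tau>2 + 8 * n + 3"
      \<comment> \<open>Selection costs \<open>90 * n ^ 4 * k\<close>, copying \<open>8 * n\<close>,
        and 9 steps are fixed: 90 + 8 + 9 is below 110.\<close>
      have "n * 1 \<le> n ^ 4 * k"
        by (intro mult_le_mono self_le_power) (use assms in auto)
      moreover have "90 * n ^ 4 * k = 90 * (n ^ 4 * k)" "110 * n ^ 4 * k = 110 * (n ^ 4 * k)" by simp_all
      ultimately have "\<tau>3 \<le> 110 * n ^ 4 * k" using 3 t2 assms(1) by linarith
      then show "Q m3 \<tau>3" unfolding Q_def using 3 w by auto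
    qed
  qed (use assms in auto)
  then have "vc S unrank Q ((\<lambda>_. 0)(0 := int r, 1 := int n, 2 := int k)) 0"
    unfolding unrank_def using assms(5) by simp
  then show ?thesis unfolding Q_def .
qed

theorem theorem11:
  shows "\<exists>(P :: prog) (C :: real). C > 0 \<and>
     (\<forall>n k r. n \<ge> 1 \<longrightarrow> k \<ge> 2 \<longrightarrow> 1 \<le> r \<longrightarrow> r \<le> card (bordered_words n k) \<longrightarrow>
        (\<exists>w t s. w \<in> bordered_words n k \<and> rank_bordered n k w = r \<and>
           computes_in P r n k w t s \<and>
           real t \<le> C * real n ^ 4 * real k * log 2 (real k) \<and>
           real s \<le> C * real n))"
proof (intro exI[of _ "compile 0 unrank"] exI[of _ 110] conjI allI impI)
  fix n k r :: nat
  assume n: "n \<ge> 1" and k: "k \<ge> 2" and r: "1 \<le> r" "r \<le> card (bordered_words n k)"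
  \<comment> \<open>Cells 0 to 23 are registers, 24 to \<open>24 + n\<close> hold the word and its
    terminator, and the table ends at \<open>24 + 2 * n\<close>.\<close>
  let ?P = "compile 0 unrank" and ?S = "25 + 2 * n"
  have code: "code_at ?P 0 ?P" using code_at_suffix[of "[]" ?P] by simp
  have "vc ?S unrank (\<lambda>m' \<tau>'.
      (\<exists>w \<in> bordered_words n k. rank_bordered n k w = r \<and> (\<forall>t<n. m' (3 + t) = int (w ! t))) \<and>
      \<tau>' \<le> 110 * n ^ 4 * k) ((\<lambda>_. 0)(0 := int r, 1 := int n, 2 := int k)) 0"
    using n k r by (intro unrank_spec) auto
  from vc_sound[OF this code, of "{0, 1, 2}"] obtain t m' T' w where
    run: "runs_to ?P (init_config r n k) t (com_len unrank, m', T')" and T': "T' \<subseteq> {..<?S}"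
    and w: "w \<in> bordered_words n k" "rank_bordered n k w = r" "\<forall>t<n. m' (3 + t) = int (w ! t)"
    and t: "t \<le> 110 * n ^ 4 * k"
    by (auto simp: init_config_def)
  have fin: "finite T'" using T' finite_subset by blast
  have "card T' \<le> ?S" using card_mono[OF _ T'] by simp
  moreover have "length w = n" using w(1) by (simp add: bordered_words_def)
  ultimately have "computes_in ?P r n k w t ?S"
    using run fin w(3) by (simp add: computes_in_def runs_to_def halted_def)
  moreover have "real t \<le> 110 * real n ^ 4 * real k * log 2 (real k)"
  proof -
    \<comment> \<open>The proved time bound has no logarithm; \<open>k \<ge> 2\<close> makes this
      factor at least 1, so it can be multiplied in.\<close>
    have "1 \<le> log 2 (real k)" using k by (simp add: le_log_iff)
    then have "110 * real n ^ 4 * real k * 1 \<le> 110 * real n ^ 4 * real k * log 2 (real k)"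
      by (intro mult_left_mono) auto
    moreover have "real t \<le> real (110 * n ^ 4 * k)" using t by (simp only: of_nat_le_iff)
    ultimately show ?thesis by simp
  qed
  moreover have "real ?S \<le> 110 * real n" using n by simp
  ultimately show "\<exists>w t s. w \<in> bordered_words n k \<and> rank_bordered n k w = r \<and>
           computes_in ?P r n k w t s \<and>
           real t \<le> 110 * real n ^ 4 * real k * log 2 (real k) \<and>
           real s \<le> 110 * real n"
    using w(1,2) by blast
qed simp

end
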